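(* For every pair of integers $(g,d)$ with $g\ge1$ and $g+2\le d\le 2g+1$, there exists a complete minimal immersion of finite total curvature in $\mathbb{R}^4$ with $d$ embedded planar ends and genus $g$, that is symmetric with respect to the origin, and whose underlying Riemann surface is hyperelliptic if $g\ge2$. Moreover, there are embedded examples when $g=1$ and $d=3$.
   Context: Generalized Weierstrass representation: up to translation, a complete immersed minimal surface of finite total curvature in $\mathbb{R}^N$ ($N\ge 3$) is represented by an immersion $X=\mathrm{Re}\int(\phi_1,\dots,\phi_N):\Sigma_g\setminus\{p_1,\dots,p_k\}\to\mathbb{R}^N$, where $\Sigma_g$ is a closed Riemann surface of genus $g$; the $\phi_j$ are meromorphic 1-forms on $\Sigma_g$ with possible poles only at $p_1,\dots,p_k$, at least one of them having a pole at each $p_i$; $\sum_j\phi_j^2\equiv0$ and $\sum_j|\phi_j|^2>0$; and the $\phi_j$ have no real periods. Each $p_i$ corresponds to an end. The genus of the immersion is $g$. Embedded planar end: $X$ has an embedded planar end at $p_i$ if there is an open neighborhood $U_i$ of $p_i$ such that the image $X(U_i\setminus\{p_i\})$ is asymptotic to a ($2$-dimensional) plane and, outside some compact subset, is a (single-valued) graph over that same plane, where all height functions have no logarithmic growth. Equivalently, $\min_j\mathrm{ord}_{p_i}\phi_j=-2$ and $\mathrm{res}_{p_i}\phi_j=0$ for all $j$. "With $d$ embedded planar ends" means $k=d$ and there is an embedded planar end at each $p_i$. Symmetric with respect to the origin means that the image of $X$ is invariant under $v\mapsto -v$. Hyperelliptic (for $g\ge2$) means that $\Sigma_g$ is the compact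 Riemann surface of $y^2=\prod_{j=1}^{2g+2}(x-\lambda_j)$ for pairwise distinct $\lambda_j\in\mathbb{C}$. *)

theory Defs
  imports "HOL-Complex_Analysis.Complex_Analysis" "HOL-Library.Disjoint_Sets"
begin

section \<open>Closed Riemann surfaces\<close>

type_synonym 'a chart = "'a set \<times> ('a \<Rightarrow> complex)"

record 'a surface =
  rs_topology :: "'a topology"
  rs_atlas :: "'a chart set"

abbreviation rs_points :: "'a surface \<Rightarrow> 'a set" where
  "rs_points S \<equiv> topspace (rs_topology S)"

definition complex_chart :: "'a topology \<Rightarrow> 'a chart \<Rightarrow> bool" where
  "complex_chart T c \<longleftrightarrow> (case c of (U, h) \<Rightarrow>
     openin T U \<and> open (h ` U) \<and>
     homeomorphic_map (subtopology T U) (top_of_set (h ` U)) h)"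

definition closed_riemann_surface :: "'a surface \<Rightarrow> bool" where
  "closed_riemann_surface S \<longleftrightarrow>
     rs_points S \<noteq> {} \<and>
     compact_space (rs_topology S) \<and>
     connected_space (rs_topology S) \<and>
     Hausdorff_space (rs_topology S) \<and>
     (\<forall>c\<in>rs_atlas S. complex_chart (rs_topology S) c) \<and>
     (\<Union>(U, h)\<in>rs_atlas S. U) = rs_points S \<and>
     (\<forall>(U, h)\<in>rs_atlas S. \<forall>(V, k)\<in>rs_atlas S.
        (k \<circ> inv_into U h) holomorphic_on h ` (U \<inter> V))"

text \<open>
  A finite CW decomposition of dimension at most two of a Hausdorff space. \<open>V\<close>, \<open>E\<close>, \<open>F\<close> are
  the sets of open cells of dimension 0, 1, 2; \<open>e\<close> and \<open>f\<close> are characteristic maps. They are only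
  required to be injective on the open interval and disc: as the space is Hausdorff and the boundary
  of a cell lies in lower cells, they are then homeomorphisms onto the open cells.
\<close>

definition cell_decomposition ::
    "'a topology \<Rightarrow> 'a set set \<Rightarrow> 'a set set \<Rightarrow> 'a set set \<Rightarrow> bool" where
  "cell_decomposition T V E F \<longleftrightarrow>
     finite V \<and> finite E \<and> finite F \<and>
     partition_on (topspace T) (V \<union> E \<union> F) \<and>
     (\<forall>c\<in>V. \<exists>v. c = {v}) \<and>
     (\<forall>c\<in>E. \<exists>e :: real \<Rightarrow> 'a.
        continuous_map (top_of_set {0..1}) T e \<and> inj_on e {0<..<1} \<and>
        e ` {0<..<1} = c \<and> e ` {0, 1} \<subseteq> \<Union>V) \<and>
     (\<forall>c\<in>F. \<exists>f :: complex \<Rightarrow> 'a.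
        continuous_map (top_of_set (cball 0 1)) T f \<and> inj_on f (ball 0 1) \<and>
        f ` ball 0 1 = c \<and> f ` sphere 0 1 \<subseteq> \<Union>(V \<union> E))"

text \<open>
  The topological genus \<open>g\<close> of a closed (orientable, connected) surface is defined through its Euler
  characteristic \<open>2 - 2g\<close>. The alternating count of cells does not depend on the decomposition.
\<close>

definition has_genus :: "'a surface \<Rightarrow> nat \<Rightarrow> bool" where
  "has_genus S g \<longleftrightarrow>
     (\<exists>V E F. cell_decomposition (rs_topology S) V E F \<and>
        int (card V) - int (card E) + int (card F) = 2 - 2 * int g)"

definition holomorphic_function :: "'a surface \<Rightarrow> 'a set \<Rightarrow> ('a \<Rightarrow> complex) \<Rightarrow> bool" where
  "holomorphic_function S W u \<longleftrightarrow>
     (\<forall>(U, h)\<in>rs_atlas S. (u \<circ> inv_into U h) holomorphic_on h ` (U \<inter> W))"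

text \<open>
  \<open>S\<close> is the compact Riemann surface of \<open>y\<^sup>2 = (x - l 0) \<dots> (x - l (2 * g + 1))\<close>, that is, the
  smooth affine curve with this equation is biholomorphic to \<open>S\<close> with finitely many points removed
  (a compact Riemann surface with this property is unique up to isomorphism). The biholomorphism is
  given by its coordinate functions \<open>x\<close> and \<open>y\<close>; holomorphy of the inverse is automatic.
\<close>

definition hyperelliptic :: "'a surface \<Rightarrow> nat \<Rightarrow> bool" where
  "hyperelliptic S g \<longleftrightarrow>
     (\<exists>(l :: nat \<Rightarrow> complex) I x y.
        inj_on l {..<2 * g + 2} \<and>
        finite I \<and> I \<subseteq> rs_points S \<and>
        holomorphic_function S (rs_points S - I) x \<and>
        holomorphic_function S (rs_points S - I) y \<and>
        homeomorphic_map (subtopology (rs_topology S) (rs_points S - I))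
          (top_of_set {(a, b). b ^ 2 = (\<Prod>j<2 * g + 2. a - l j)}) (\<lambda>p. (x p, y p)))"


section \<open>Weierstrass data\<close>

text \<open>
  A meromorphic 1-form, holomorphic outside the finite set \<open>P\<close>, is a family of local coefficients:
  it reads \<open>\<omega> (U, h) z dz\<close> in the chart \<open>(U, h)\<close>. The values of the coefficients at (the
  coordinates of) points of \<open>P\<close> are irrelevant.
\<close>

definition meromorphic_form ::
    "'a surface \<Rightarrow> 'a set \<Rightarrow> ('a chart \<Rightarrow> complex \<Rightarrow> complex) \<Rightarrow> bool" where
  "meromorphic_form S P \<omega> \<longleftrightarrow>
     (\<forall>(U, h)\<in>rs_atlas S.
        \<omega> (U, h) meromorphic_on h ` U \<and> \<omega> (U, h) holomorphic_on h ` (U - P)) \<and>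
     (\<forall>(U, h)\<in>rs_atlas S. \<forall>(V, k)\<in>rs_atlas S. \<forall>p\<in>U \<inter> V - P.
        \<omega> (U, h) (h p) = \<omega> (V, k) (k p) * deriv (k \<circ> inv_into U h) (h p))"

definition form_has_pole ::
    "'a surface \<Rightarrow> ('a chart \<Rightarrow> complex \<Rightarrow> complex) \<Rightarrow> 'a \<Rightarrow> bool" where
  "form_has_pole S \<omega> p \<longleftrightarrow> (\<exists>(U, h)\<in>rs_atlas S. p \<in> U \<and> is_pole (\<omega> (U, h)) (h p))"

text \<open>
  \<open>X = Re \<integral> \<phi>\<close> is expressed by \<open>dX j = Re (\<phi> j)\<close> for all \<open>j\<close>. A single-valued such \<open>X\<close> exists
  precisely if the forms \<open>\<phi> j\<close> have no real periods, and it is unique up to translation.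
\<close>

definition real_primitive ::
    "'a surface \<Rightarrow> 'a set \<Rightarrow> ('n \<Rightarrow> 'a chart \<Rightarrow> complex \<Rightarrow> complex) \<Rightarrow> ('a \<Rightarrow> real ^ 'n::finite) \<Rightarrow> bool"
  where
  "real_primitive S P \<phi> X \<longleftrightarrow>
     (\<forall>(U, h)\<in>rs_atlas S. \<forall>p\<in>U - P.
        ((X \<circ> inv_into U h) has_derivative (\<lambda>v. \<chi> j. Re (\<phi> j (U, h) (h p) * v))) (at (h p)))"

text \<open>
  A complete minimal immersion \<open>X\<close> of finite total curvature of \<open>S\<close> punctured at the points of \<open>P\<close>,
  given by its generalized Weierstrass representation.
\<close>

definition complete_minimal_immersion ::
    "'a surface \<Rightarrow> 'a set \<Rightarrow> ('n \<Rightarrow> 'a chart \<Rightarrow> complex \<Rightarrow> complex) \<Rightarrow> ('a \<Rightarrow> real ^ 'n::finite) \<Rightarrow> bool"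
  where
  "complete_minimal_immersion S P \<phi> X \<longleftrightarrow>
     closed_riemann_surface S \<and> finite P \<and> P \<subseteq> rs_points S \<and>
     (\<forall>j. meromorphic_form S P (\<phi> j)) \<and>
     (\<forall>p\<in>P. \<exists>j. form_has_pole S (\<phi> j) p) \<and>
     (\<forall>(U, h)\<in>rs_atlas S. \<forall>p\<in>U - P. (\<Sum>j\<in>UNIV. (\<phi> j (U, h) (h p)) ^ 2) = 0) \<and>
     (\<forall>(U, h)\<in>rs_atlas S. \<forall>p\<in>U - P. (\<Sum>j\<in>UNIV. (cmod (\<phi> j (U, h) (h p))) ^ 2) > 0) \<and>
     real_primitive S P \<phi> X"

text \<open>
  On the plane \<open>L\<close>, \<open>closest_point L\<close> is the orthogonal projection, and \<open>v - closest_point L v\<close> is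
  the vector of heights of \<open>v\<close> over \<open>L\<close>. The heights tend to 0 at the end, so that they have no
  logarithmic growth. Outside the compact set \<open>K\<close>, the surface is a single-valued graph over the
  complement of a compact set \<open>C\<close> in \<open>L\<close>; injectivity is required of the parametrized surface and not
  only of its image, which excludes ends that are multiple covers of their image.
\<close>

definition embedded_planar_end ::
    "'a surface \<Rightarrow> 'a set \<Rightarrow> ('a \<Rightarrow> real ^ 'n::finite) \<Rightarrow> 'a \<Rightarrow> bool" where
  "embedded_planar_end S P X p \<longleftrightarrow>
     (\<exists>U L. openin (rs_topology S) U \<and> U \<inter> P = {p} \<and>
        affine L \<and> aff_dim L = 2 \<and>
        ((\<lambda>q. X q - closest_point L (X q)) \<longlongrightarrow> 0) (atin (rs_topology S) p) \<and>
        (\<exists>K C. compact K \<and> compact C \<and>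
           bij_betw (\<lambda>q. closest_point L (X q)) {q \<in> U - {p}. X q \<notin> K} (L - C)))"

definition symmetric_about_origin :: "'a::ab_group_add set \<Rightarrow> bool" where
  "symmetric_about_origin A \<longleftrightarrow> uminus ` A = A"

text \<open>All properties claimed of the examples with \<open>d\<close> ends and genus \<open>g\<close>, except embeddedness.\<close>

definition symmetric_planar_example ::
    "nat \<Rightarrow> nat \<Rightarrow> 'a surface \<Rightarrow> 'a set \<Rightarrow> ('n \<Rightarrow> 'a chart \<Rightarrow> complex \<Rightarrow> complex) \<Rightarrow>
     ('a \<Rightarrow> real ^ 'n::finite) \<Rightarrow> bool" where
  "symmetric_planar_example g d S P \<phi> X \<longleftrightarrow>
     complete_minimal_immersion S P \<phi> X \<and>
     has_genus S g \<and>
     card P = d \<and> (\<forall>p\<in>P. embedded_planar_end S P X p) \<and>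
     symmetric_about_origin (X ` (rs_points S - P)) \<and>
     (g \<ge> 2 \<longrightarrow> hyperelliptic S g)"

definition embedded :: "'a surface \<Rightarrow> 'a set \<Rightarrow> ('a \<Rightarrow> 'b::topological_space) \<Rightarrow> bool" where
  "embedded S P X \<longleftrightarrow>
     embedding_map (subtopology (rs_topology S) (rs_points S - P)) euclidean X"

text \<open>
  The points of a surface have to be taken from a fixed type. Any type of the cardinality of the
  continuum serves, since every Riemann surface can be carried over to it along a bijection; the
  topology of the surface is part of the data and unrelated to a topology of the type.
\<close>

type_synonym point = "(complex \<times> complex) + (complex \<times> complex)"

end

theory Submission
  imports Defs
begin

text \<open>
  A holomorphic curve in \<open>\<complex>\<^sup>2 = \<real>\<^sup>4\<close> is minimal. On the hyperelliptic curve \<open>y\<^sup>2 = x\<^sup>2\<^sup>n - 1\<close> of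
  genus \<open>g = n - 1\<close>, let \<open>R\<close> be the product of \<open>x - \<omega>\<^sup>j\<close> over \<open>j < d\<close>, where \<open>\<omega>\<close> is a primitive
  root of unity of order \<open>2n\<close>. The functions \<open>f\<^sub>2 = y / R(x)\<close> and \<open>f\<^sub>1 = x\<^sup>m f\<^sub>2\<close> with \<open>m = d - n\<close> have
  simple poles at the \<open>d\<close> branch points \<open>(\<omega>\<^sup>j, 0)\<close> with \<open>j < d\<close> and no others, and they are odd under
  \<open>y \<mapsto> - y\<close>, whence the symmetry. Exactness of the differentials makes the simple poles embedded
  planar ends. The map \<open>(f\<^sub>1, f\<^sub>2)\<close> can only fail to be an immersion over \<open>x = 0\<close> and \<open>x = \<infinity>\<close>, where it
  suffices that \<open>R'(0)\<close> and the corresponding derivative at infinity do not vanish; both are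
  geometric sums of powers of \<open>\<omega>\<close> with \<open>d < 2n\<close> terms. For \<open>n = 2\<close> and \<open>d = 3\<close> one has \<open>x = f\<^sub>1 / f\<^sub>2\<close>,
  and only three points have \<open>f\<^sub>2 = 0\<close>; so the map is injective, and it is proper.
\<close>

section \<open>Two copies of the affine curve glued along \<open>x \<noteq> 0\<close>\<close>

text \<open>The second copy has coordinates u = 1/x and v = i*y/x^n. The factor i makes v^2 = u^(2n)
  - 1, the very equation of the first copy, so charts, discs and the immersion criterion are
  established once on \<open>curve\<close> and serve both sides; infinity becomes the locus u = 0.
  The exponent m = d - n is the largest one for which x^m f2 stays finite at infinity: y/R behaves
  like x^(n-d) there, so f2 vanishes to order m and f1 does not vanish. Passing to u and v therefore
  swaps the two functions. The places x = 0 and u = 0 are critical because, once df2 = 0, the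
  differential df1 reduces to m x^(m-1) f2 dx. An end is asymptotic to the plane f1 = c f2, where c
  is the value of x^m at the branch point. The local coordinate there is y, and x is a function of
  y^2, so x^m - c has a double zero against the simple pole of f2, and the heights tend to
  0.\<close>

locale hyperelliptic_gluing =
  fixes n :: nat
  assumes n_ge_2: "n \<ge> 2"
begin

definition curve :: "(complex \<times> complex) set" where
  "curve = {(x, y). y ^ 2 = x ^ (2 * n) - 1}"

definition flip :: "complex \<Rightarrow> complex \<times> complex \<Rightarrow> complex \<times> complex" where
  "flip \<kappa> = (\<lambda>(x, y). (1 / x, \<kappa> * y / x ^ n))"

text \<open>A quotient is avoided by normal forms: a point seen by both copies is stored with its
  first-copy coordinates, and only the two points with u = 0 carry the tag
  \<open>Inr\<close>.\<close>

definition at_inf :: "complex \<times> complex \<Rightarrow> point" where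
  "at_inf w = (if fst w = 0 then Inr w else Inl (flip \<i> w))"

definition sides :: "(complex \<times> complex \<Rightarrow> point) set" where
  "sides = {Inl, at_inf}"

definition surf_points :: "point set" where
  "surf_points = Inl ` curve \<union> at_inf ` curve"

text \<open>This is the final topology for the two parametrizations, so openness is tested on
  \<open>curve\<close>.\<close>

definition surf_top :: "point topology" where
  "surf_top = topology (\<lambda>W. W \<subseteq> surf_points \<and>
     (\<forall>e\<in>sides. openin (top_of_set curve) (curve \<inter> e -` W)))"

lemma openin_surf_top:
  "openin surf_top W \<longleftrightarrow> W \<subseteq> surf_points \<and>
     (\<forall>e\<in>sides. openin (top_of_set curve) (curve \<inter> e -` W))"
proof -
  have "istopology (\<lambda>W. W \<subseteq> surf_points \<and>
     (\<forall>e\<in>sides. openin (top_of_set curve) (curve \<inter> e -` W)))"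
    unfolding istopology_def
  proof (intro conjI allI impI ballI)
    fix S T e
    assume S: "S \<subseteq> surf_points \<and> (\<forall>e\<in>sides. openin (top_of_set curve) (curve \<inter> e -` S))"
      and T: "T \<subseteq> surf_points \<and> (\<forall>e\<in>sides. openin (top_of_set curve) (curve \<inter> e -` T))"
    show "S \<inter> T \<subseteq> surf_points" using S by auto
    assume "e \<in> sides"
    moreover have "curve \<inter> e -` (S \<inter> T) = (curve \<inter> e -` S) \<inter> (curve \<inter> e -` T)" by auto
    ultimately show "openin (top_of_set curve) (curve \<inter> e -` (S \<inter> T))"
      using S T by auto
  next
    fix \<K> e
    assume K: "\<forall>K\<in>\<K>. K \<subseteq> surf_points \<and> (\<forall>e\<in>sides. openin (top_of_set curve) (curve \<inter> e -` K))"
    show "\<Union>\<K> \<subseteq> surf_points" using K by auto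
    assume "e \<in> sides"
    moreover have "curve \<inter> e -` (\<Union>\<K>) = (\<Union>K\<in>\<K>. curve \<inter> e -` K)" by auto
    moreover have "openin (top_of_set curve) (\<Union>K\<in>\<K>. curve \<inter> e -` K)"
      using K \<open>e \<in> sides\<close> by (intro openin_Union) auto
    ultimately show "openin (top_of_set curve) (curve \<inter> e -` (\<Union>\<K>))"
      by metis
  qed
  then show ?thesis by (simp add: surf_top_def)
qed

lemma side_in_surf: "e \<in> sides \<Longrightarrow> w \<in> curve \<Longrightarrow> e w \<in> surf_points"
  by (auto simp: sides_def surf_points_def)

lemma topspace_surf [simp]: "topspace surf_top = surf_points"
proof
  show "topspace surf_top \<subseteq> surf_points"
    using openin_surf_top[of "topspace surf_top"] by auto
  have "curve \<inter> e -` surf_points = curve" if "e \<in> sides" for e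
    using side_in_surf[OF that] by auto
  then have "openin surf_top surf_points" by (auto simp: openin_surf_top)
  then show "surf_points \<subseteq> topspace surf_top" by (rule openin_subset)
qed

lemma continuous_side: "e \<in> sides \<Longrightarrow> continuous_map (top_of_set curve) surf_top e"
  unfolding continuous_map
  by (auto simp: side_in_surf openin_surf_top Int_def vimage_def)

text \<open>Dividing the equation by x^(2n) yields (y/x^n)^2 = 1 - (1/x)^(2n); a factor of square -1
  restores the sign.\<close>

lemma flip_curve:
  assumes "w \<in> curve" "fst w \<noteq> 0" "\<kappa>\<^sup>2 = -1"
  shows "flip \<kappa> w \<in> curve"
proof -
  obtain x y where w: "w = (x, y)" by (cases w)
  have x: "x \<noteq> 0" and y: "y\<^sup>2 = x ^ (2 * n) - 1" using assms w by (auto simp: curve_def)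
  have "(\<kappa> * y / x ^ n)\<^sup>2 = - (x ^ (2 * n) - 1) / x ^ (2 * n)"
    by (simp add: power_divide power_mult_distrib assms(3) y power_mult[symmetric] mult.commute)
  also have "\<dots> = (1 / x) ^ (2 * n) - 1"
    using x by (simp add: field_simps)
  finally show ?thesis by (simp add: w flip_def curve_def)
qed

lemma flip_flip: "fst w \<noteq> 0 \<Longrightarrow> \<kappa> * \<kappa>' = 1 \<Longrightarrow> flip \<kappa> (flip \<kappa>' w) = w"
  by (cases w) (auto simp: flip_def field_simps)

lemma fst_flip [simp]: "fst (flip \<kappa> w) = 1 / fst w"
  by (cases w) (auto simp: flip_def)

lemma continuous_on_flip: "continuous_on {w. fst w \<noteq> 0} (flip \<kappa>)"
proof -
  have "flip \<kappa> = (\<lambda>w. (1 / fst w, \<kappa> * snd w / fst w ^ n))"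
    by (auto simp: flip_def)
  then show ?thesis by (auto intro!: continuous_intros)
qed

lemma at_inf_eq_Inl:
  assumes "u \<in> curve" "w \<in> curve"
  shows "at_inf u = Inl w \<longleftrightarrow> fst w \<noteq> 0 \<and> u = flip (- \<i>) w"
    and "at_inf u = Inl w \<longleftrightarrow> fst u \<noteq> 0 \<and> w = flip \<i> u"
proof -
  show *: "at_inf u = Inl w \<longleftrightarrow> fst u \<noteq> 0 \<and> w = flip \<i> u"
    by (auto simp: at_inf_def)
  show "at_inf u = Inl w \<longleftrightarrow> fst w \<noteq> 0 \<and> u = flip (- \<i>) w"
    unfolding * using flip_flip[of u "-\<i>" \<i>] flip_flip[of w "\<i>" "-\<i>"] by auto
qed

lemma inj_side: "e \<in> sides \<Longrightarrow> inj_on e curve"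
proof -
  have "inj_on at_inf curve"
  proof (rule inj_onI)
    fix u w assume "u \<in> curve" "w \<in> curve" "at_inf u = at_inf w"
    then consider "u = w" | "fst u \<noteq> 0" "fst w \<noteq> 0" "flip \<i> u = flip \<i> w"
      by (auto simp: at_inf_def split: if_splits)
    then show "u = w"
    proof cases
      case 2
      then have "flip (- \<i>) (flip \<i> u) = flip (- \<i>) (flip \<i> w)" by simp
      then show ?thesis using 2(1,2) by (simp add: flip_flip)
    qed
  qed
  then show "e \<in> sides \<Longrightarrow> inj_on e curve" by (auto simp: sides_def)
qed

text \<open>The change of coordinates between the two copies of the curve is \<^term>\<open>flip \<kappa>\<close> with
  \<open>\<kappa> = \<plusminus>\<i>\<close>; its square is the hyperelliptic involution.\<close>

definition trans_map :: "(complex \<times> complex \<Rightarrow> point) \<Rightarrow> (complex \<times> complex \<Rightarrow> point) \<Rightarrow>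
    complex \<times> complex \<Rightarrow> complex \<times> complex" where
  "trans_map e e' = (if e' = e then id else flip (if e = Inl then - \<i> else \<i>))"

lemma Inl_neq_at_inf: "Inl \<noteq> at_inf"
proof
  assume "Inl = at_inf"
  then have "Inl (0, 0) = at_inf (0, 0)" by (rule fun_cong)
  then show False by (simp add: at_inf_def)
qed

text \<open>The gluing relation in full, uniform in the two copies. Separation of points,
  disjointness of cells and holomorphy of the transitions are all reduced to it.\<close>

lemma side_eq_side:
  assumes "e \<in> sides" "e' \<in> sides" "w \<in> curve" "w' \<in> curve"
  shows "e' w' = e w \<longleftrightarrow> (e' \<noteq> e \<longrightarrow> fst w \<noteq> 0) \<and> w' = trans_map e e' w"
proof -
  consider "e' = e" | "e = Inl" "e' = at_inf" | "e = at_inf" "e' = Inl"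
    using assms(1,2) by (auto simp: sides_def)
  then show ?thesis
  proof cases
    case 1
    then show ?thesis
      using inj_on_eq_iff[OF inj_side[OF assms(1)] assms(4,3)] by (simp add: trans_map_def)
  next
    case 2
    then show ?thesis using at_inf_eq_Inl(1)[OF assms(4,3)] Inl_neq_at_inf by (simp add: trans_map_def)
  next
    case 3
    then show ?thesis
      using at_inf_eq_Inl(2)[OF assms(3,4)] Inl_neq_at_inf by (auto simp: trans_map_def)
  qed
qed

lemma trans_map_curve:
  assumes "e \<in> sides" "e' \<in> sides" "w \<in> curve" "e' \<noteq> e \<longrightarrow> fst w \<noteq> 0"
  shows "trans_map e e' w \<in> curve"
  using assms by (auto simp: trans_map_def intro!: flip_curve)

lemma continuous_trans_map: "continuous_on {w. e' \<noteq> e \<longrightarrow> fst w \<noteq> 0} (trans_map e e')"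
  using continuous_on_flip by (auto simp: trans_map_def)

text \<open>Seen from the other copy, the image of \<open>W\<close> is the preimage of
  \<open>W\<close> under the transition map, which is continuous on the open part x \<noteq> 0. With
  injectivity this makes each copy an open subspace.\<close>

lemma open_side:
  assumes e: "e \<in> sides" and W: "openin (top_of_set curve) W"
  shows "openin surf_top (e ` W)"
  unfolding openin_surf_top
proof (intro conjI ballI)
  have Wc: "W \<subseteq> curve" using W openin_subset by fastforce
  show "e ` W \<subseteq> surf_points" using side_in_surf[OF e] Wc by auto
  fix e' assume e': "e' \<in> sides"
  let ?D = "curve \<inter> {w. e \<noteq> e' \<longrightarrow> fst w \<noteq> 0}"
  have "curve \<inter> e' -` (e ` W) = ?D \<inter> trans_map e' e -` W"
  proof (intro set_eqI iffI)
    fix w assume w: "w \<in> curve \<inter> e' -` (e ` W)"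
    then obtain w' where w': "w' \<in> W" "e w' = e' w" by (metis IntD2 imageE vimageE)
    then show "w \<in> ?D \<inter> trans_map e' e -` W"
      using side_eq_side[OF e' e, of w w'] Wc w by auto
  next
    fix w assume w: "w \<in> ?D \<inter> trans_map e' e -` W"
    then have "e (trans_map e' e w) = e' w"
      using side_eq_side[OF e' e, of w "trans_map e' e w"] Wc by auto
    then have "e' w \<in> e ` W" using w by (metis IntD2 imageI vimageE)
    then show "w \<in> curve \<inter> e' -` (e ` W)" using w by simp
  qed
  moreover have "openin (top_of_set ?D) (?D \<inter> trans_map e' e -` W)"
  proof (rule continuous_openin_preimage[OF _ _ W])
    show "continuous_on ?D (trans_map e' e)"
      using continuous_trans_map by (rule continuous_on_subset) auto
    show "trans_map e' e \<in> ?D \<rightarrow> curve" using trans_map_curve[OF e' e] by auto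
  qed
  moreover have "openin (top_of_set curve) ?D"
  proof (rule openin_open_Int)
    have "open {w::complex \<times> complex. fst w \<noteq> 0}"
      by (intro open_Collect_neq continuous_intros)
    then show "open {w::complex \<times> complex. e \<noteq> e' \<longrightarrow> fst w \<noteq> 0}" by (cases "e = e'") auto
  qed
  ultimately show "openin (top_of_set curve) (curve \<inter> e' -` e ` W)"
    using openin_trans by metis
qed

lemma embedding_side: "e \<in> sides \<Longrightarrow> embedding_map (top_of_set curve) surf_top e"
  by (intro injective_open_imp_embedding_map continuous_side)
     (auto simp: open_map_def open_side inj_side)

text \<open>The gluing inverts x, so a point with |x| > 1 in one copy has |x| < 1 in the other. The
  parts over the closed unit disc thus suffice, which is where compactness comes from.\<close>

lemma surf_points_cases:
  assumes "q \<in> surf_points"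
  obtains e x y where "e \<in> sides" "(x, y) \<in> curve" "cmod x \<le> 1" "q = e (x, y)"
proof -
  note result = that
  have Inl: thesis if "(x, y) \<in> curve" "q = Inl (x, y)" for x y
  proof (cases "cmod x \<le> 1")
    case True then show thesis using that result[of Inl x y] by (auto simp: sides_def)
  next
    case False
    let ?u = "flip (- \<i>) (x, y)"
    have x: "x \<noteq> 0" using False by auto
    have u: "?u \<in> curve" using x that by (intro flip_curve) auto
    have "q = at_inf ?u" using at_inf_eq_Inl(1)[OF u that(1)] that x by auto
    moreover have "cmod (fst ?u) \<le> 1" using False by (simp add: norm_divide divide_le_eq_1)
    ultimately show thesis using u result[of at_inf "fst ?u" "snd ?u"]
      unfolding prod.collapse by (simp add: sides_def)
  qed
  from assms obtain w where "w \<in> curve" "q = Inl w \<or> q = at_inf w"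
    unfolding surf_points_def by blast
  then consider "w \<in> curve" "q = Inl w" | "flip \<i> w \<in> curve" "q = Inl (flip \<i> w)"
    | "w \<in> curve" "fst w = 0" "q = at_inf w"
    using flip_curve[of w \<i>] by (cases "fst w = 0") (auto simp: at_inf_def)
  then show thesis
  proof cases
    case 3
    then show thesis using result[of at_inf "fst w" "snd w"]
      unfolding prod.collapse by (simp add: sides_def)
  qed (metis Inl prod.collapse)+
qed

lemma Hausdorff_surf: "Hausdorff_space surf_top"
proof -
  let ?B = "{w. w \<in> curve \<and> cmod (fst w) < 1}"
  have B: "openin (top_of_set curve) ?B"
  proof -
    have "open {w::complex \<times> complex. cmod (fst w) < 1}"
      by (intro open_Collect_less continuous_intros)
    then have "openin (top_of_set curve) (curve \<inter> {w. cmod (fst w) < 1})"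
      by (rule openin_open_Int)
    then show ?thesis by (simp add: Int_def)
  qed
  have same: "\<exists>U V. openin surf_top U \<and> openin surf_top V \<and> e w \<in> U \<and> e w' \<in> V \<and> disjnt U V"
    if e: "e \<in> sides" and w: "w \<in> curve" "w' \<in> curve" "w \<noteq> w'" for e w w'
  proof -
    obtain U V where UV: "open U" "open V" "w \<in> U" "w' \<in> V" "U \<inter> V = {}"
      using \<open>w \<noteq> w'\<close> hausdorff by meson
    have "e ` (curve \<inter> U) \<inter> e ` (curve \<inter> V) = {}"
      using inj_side[OF e] UV(5) by (auto simp: inj_on_def)
    then show ?thesis
      using UV w open_side[OF e openin_open_Int] by (intro exI[of _ "e ` (curve \<inter> U)"]
        exI[of _ "e ` (curve \<inter> V)"]) (auto simp: disjnt_def)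
  qed
  have main: "\<exists>U V. openin surf_top U \<and> openin surf_top V \<and> e w \<in> U \<and> e' w' \<in> V \<and> disjnt U V"
    if ee: "e \<in> sides" "e' \<in> sides" and w: "w \<in> curve" "w' \<in> curve" and ne: "e w \<noteq> e' w'"
      and sm: "cmod (fst w) \<le> 1" "cmod (fst w') \<le> 1" for e e' w w'
  proof (cases "e' = e \<or> fst w \<noteq> 0 \<or> fst w' \<noteq> 0")
    case False
    \<comment> \<open>Two points over x = 0 in different copies are the only pair not visible in a
      common copy. The gluing relation gives |x||x'| = 1, so the parts over |x| < 1 are
      disjoint.\<close>
    have "e ` ?B \<inter> e' ` ?B = {}"
    proof (rule ccontr)
      assume "e ` ?B \<inter> e' ` ?B \<noteq> {}"
      then obtain q where q: "q \<in> e ` ?B" "q \<in> e' ` ?B" by blast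
      obtain a where a: "a \<in> ?B" "q = e a" using q(1) by (rule imageE)
      obtain b where b: "b \<in> ?B" "q = e' b" using q(2) by (rule imageE)
      have "fst a \<noteq> 0" "b = trans_map e e' a"
        using side_eq_side[OF ee, of a b] a b False by simp_all
      then have "fst b * fst a = 1" using False by (simp add: trans_map_def)
      then have "cmod (fst b) * cmod (fst a) = 1" by (metis norm_mult norm_one)
      moreover have "cmod (fst b) * cmod (fst a) < 1 * 1"
        using a b by (intro mult_strict_mono') auto
      ultimately show False by simp
    qed
    then show ?thesis
      using False w open_side[OF _ B] ee
      by (intro exI[of _ "e ` ?B"] exI[of _ "e' ` ?B"]) (auto simp: disjnt_def)
  next
    case True
    then consider "e' = e \<or> fst w \<noteq> 0" | "fst w' \<noteq> 0" by auto
    then show ?thesis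
    proof cases
      case 1
      have "e w = e' (trans_map e e' w)" "trans_map e e' w \<in> curve"
        using side_eq_side[OF ee, of w "trans_map e e' w"] trans_map_curve[OF ee w(1)] 1 w by auto
      then show ?thesis using same[OF ee(2) _ w(2), of "trans_map e e' w"] ne by auto
    next
      case 2
      have "e' w' = e (trans_map e' e w')" "trans_map e' e w' \<in> curve"
        using side_eq_side[OF ee(2,1), of w' "trans_map e' e w'"] trans_map_curve[OF ee(2,1) w(2)] 2 w by auto
      then show ?thesis using same[OF ee(1) w(1), of "trans_map e' e w'"] ne by auto
    qed
  qed
  show ?thesis
    unfolding Hausdorff_space_def topspace_surf
  proof (intro allI impI)
    fix p q assume pq: "p \<in> surf_points \<and> q \<in> surf_points \<and> p \<noteq> q"
    obtain e x y where p: "e \<in> sides" "(x, y) \<in> curve" "cmod x \<le> 1" "p = e (x, y)"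
      using pq surf_points_cases by metis
    obtain e' x' y' where q: "e' \<in> sides" "(x', y') \<in> curve" "cmod x' \<le> 1" "q = e' (x', y')"
      using pq surf_points_cases by metis
    show "\<exists>U V. openin surf_top U \<and> openin surf_top V \<and> p \<in> U \<and> q \<in> V \<and> disjnt U V"
      using main[OF p(1) q(1) p(2) q(2)] p q pq by auto
  qed
qed

end

section \<open>Coordinate charts\<close>

lemma Re_csqrt_pos: "z \<notin> \<real>\<^sub>\<le>\<^sub>0 \<Longrightarrow> Re (csqrt z) > 0"
proof (rule ccontr)
  assume z: "z \<notin> \<real>\<^sub>\<le>\<^sub>0" and "\<not> Re (csqrt z) > 0"
  then have "Re (csqrt z) = 0" using csqrt_principal[of z] by auto
  then have "(csqrt z)\<^sup>2 = - complex_of_real ((Im (csqrt z))\<^sup>2)"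
    by (auto simp: complex_eq_iff power2_eq_square)
  then have "z = complex_of_real (- (Im (csqrt z))\<^sup>2)" by simp
  then have "z \<in> \<real>\<^sub>\<le>\<^sub>0" by (metis nonpos_Reals_of_real_iff neg_le_0_iff_le zero_le_power2)
  with z show False by simp
qed

lemma square_nonpos_Reals: "Re z > 0 \<Longrightarrow> z\<^sup>2 \<notin> \<real>\<^sub>\<le>\<^sub>0"
  by (auto simp: complex_nonpos_Reals_iff power2_eq_square mult_le_0_iff)

text \<open>Off the origin the closed half-plane avoids the branch cut, and at the origin |csqrt w|
  = sqrt |w|. The origin has to be included because the two sheets over the unit disc meet where 1 -
  x^(2n) = 0.\<close>

lemma continuous_on_csqrt_right_half_plane: "continuous_on {z. Re z \<ge> 0} csqrt"
proof (rule continuous_at_imp_continuous_on, rule ballI)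
  fix z assume "z \<in> {z. Re z \<ge> 0}"
  show "isCont csqrt z"
  proof (cases "z = 0")
    case True
    have "((\<lambda>w. sqrt (norm (w::complex))) \<longlongrightarrow> sqrt (norm (0::complex))) (at 0)"
      by (rule tendsto_real_sqrt[OF tendsto_norm[OF tendsto_ident_at]])
    then have "((\<lambda>w. norm (csqrt w)) \<longlongrightarrow> 0) (at 0)" by simp
    then have "(csqrt \<longlongrightarrow> 0) (at 0)" by (rule tendsto_norm_zero_cancel)
    then show ?thesis using True by (simp add: isCont_def)
  next
    case False
    then show ?thesis using \<open>z \<in> _\<close>
      by (intro continuous_at_csqrt) (auto simp: complex_nonpos_Reals_iff complex_eq_iff)
  qed
qed

context hyperelliptic_gluing
begin

definition coord_charts :: "((complex \<times> complex) set \<times> (complex \<times> complex \<Rightarrow> complex)) set" where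
  "coord_charts = {(W, k). openin (top_of_set curve) W \<and> k \<in> {fst, snd} \<and> inj_on k W \<and>
     open (k ` W) \<and> (\<lambda>z. fst (inv_into W k z)) holomorphic_on k ` W \<and>
     (\<lambda>z. snd (inv_into W k z)) holomorphic_on k ` W}"

definition surf :: "point surface" where
  "surf = \<lparr>rs_topology = surf_top,
     rs_atlas = {(e ` W, k \<circ> inv_into curve e) | e W k. e \<in> sides \<and> (W, k) \<in> coord_charts}\<rparr>"

lemma rs_topology_surf [simp]: "rs_topology surf = surf_top"
  by (simp add: surf_def)

lemma atlas_cases:
  assumes "(U, h) \<in> rs_atlas surf"
  obtains e W k where "e \<in> sides" "(W, k) \<in> coord_charts" "U = e ` W" "h = k \<circ> inv_into curve e"
  using assms by (auto simp: surf_def)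

lemma coord_chartI:
  assumes D: "open D" "\<xi> holomorphic_on D" "\<eta> holomorphic_on D" "k \<in> {fst, snd}"
    and k: "\<And>z. z \<in> D \<Longrightarrow> k (\<xi> z, \<eta> z) = z"
    and W: "W = (\<lambda>z. (\<xi> z, \<eta> z)) ` D" "openin (top_of_set curve) W"
  shows "(W, k) \<in> coord_charts" "k ` W = D"
    "\<And>z. z \<in> D \<Longrightarrow> inv_into W k z = (\<xi> z, \<eta> z)"
proof -
  show kW: "k ` W = D" using k by (force simp: W(1) image_iff)
  have inj: "inj_on k W" unfolding W(1) by (auto simp: inj_on_def k)
  show inv: "inv_into W k z = (\<xi> z, \<eta> z)" if "z \<in> D" for z
    by (rule inv_into_f_eq[OF inj]) (use that k W(1) in auto)
  show "(W, k) \<in> coord_charts"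
    using D W(2) kW inj inv by (auto simp: coord_charts_def cong: holomorphic_cong)
qed

text \<open>Away from y = 0 the coordinate x is local. Dividing by y0^2 moves the value under the
  root at the base point to 1, off the branch cut; the principal root then picks out exactly the
  points with y/y0 in the open right half-plane.\<close>

lemma coord_chart_fst:
  assumes "(x0, y0) \<in> curve" "y0 \<noteq> 0"
  obtains W where "(W, fst) \<in> coord_charts" "(x0, y0) \<in> W"
proof
  define D where "D = {x::complex. (x ^ (2 * n) - 1) / y0\<^sup>2 \<notin> \<real>\<^sub>\<le>\<^sub>0}"
  define \<eta> where "\<eta> = (\<lambda>x::complex. y0 * csqrt ((x ^ (2 * n) - 1) / y0\<^sup>2))"
  define W where "W = (\<lambda>x. (x, \<eta> x)) ` D"
  have "open ((\<lambda>x::complex. (x ^ (2 * n) - 1) / y0\<^sup>2) -` (- \<real>\<^sub>\<le>\<^sub>0))"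
    using assms(2) by (intro open_vimage continuous_intros) auto
  then have D: "open D" by (simp add: D_def vimage_def)
  have W': "W = curve \<inter> {w. Re (snd w / y0) > 0}"
  proof (intro set_eqI iffI)
    fix w assume "w \<in> W"
    then obtain x where x: "x \<in> D" "w = (x, \<eta> x)" by (auto simp: W_def)
    then show "w \<in> curve \<inter> {w. Re (snd w / y0) > 0}"
      using assms(2) Re_csqrt_pos by (auto simp: D_def \<eta>_def curve_def power_mult_distrib)
  next
    fix w assume w: "w \<in> curve \<inter> {w. Re (snd w / y0) > 0}"
    obtain x y where xy: "w = (x, y)" by (cases w)
    have eq: "(x ^ (2 * n) - 1) / y0\<^sup>2 = (y / y0)\<^sup>2"
      using w by (simp add: xy curve_def power_divide)
    have "x \<in> D" using w square_nonpos_Reals by (simp add: D_def eq xy)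
    moreover have "y = \<eta> x"
      using w assms(2) csqrt_unique[OF eq[symmetric]] by (simp add: \<eta>_def xy)
    ultimately show "w \<in> W" by (auto simp: W_def xy)
  qed
  have "open {w::complex \<times> complex. Re (snd w / y0) > 0}"
    using assms(2) by (intro open_Collect_less continuous_intros) auto
  then have open_W: "openin (top_of_set curve) W" unfolding W' by (rule openin_open_Int)
  show "(W, fst) \<in> coord_charts"
  proof (rule coord_chartI(1)[OF D _ _ _ _ W_def open_W])
    show "\<eta> holomorphic_on D" unfolding \<eta>_def D_def
      using assms(2) by (intro holomorphic_intros) auto
  qed auto
  show "(x0, y0) \<in> W" using assms by (simp add: W')
qed

text \<open>At a branch point x^(2n) - 1 has a simple zero, hence a local inverse \<open>g\<close>,
  and x = g(y^2) is a holomorphic function of y.\<close>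

lemma coord_chart_snd:
  assumes "(x0, 0) \<in> curve"
  obtains W where "(W, snd) \<in> coord_charts" "(x0, 0) \<in> W"
proof -
  let ?p = "\<lambda>x::complex. x ^ (2 * n) - 1"
  have x0: "x0 ^ (2 * n) = 1" using assms by (simp add: curve_def)
  then have x0': "x0 \<noteq> 0" using n_ge_2 by (auto simp: power_0_left)
  have holp: "?p holomorphic_on S" for S by (intro holomorphic_intros)
  have "deriv ?p x0 \<noteq> 0"
  proof -
    have "(?p has_field_derivative of_nat (2 * n) * x0 ^ (2 * n - 1)) (at x0)"
      by (auto intro!: derivative_eq_intros)
    then have "deriv ?p x0 = of_nat (2 * n) * x0 ^ (2 * n - 1)" by (rule DERIV_imp_deriv)
    then show ?thesis using x0' n_ge_2 by simp
  qed
  then obtain r where r: "r > 0" "inj_on ?p (ball x0 r)"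
    using has_complex_derivative_locally_injective[OF holp[of UNIV], of x0] by auto
  obtain g where g: "g holomorphic_on (?p ` ball x0 r)" "\<And>z. z \<in> ball x0 r \<Longrightarrow> g (?p z) = z"
    using holomorphic_has_inverse[OF holp open_ball r(2)] by metis
  define D where "D = {y::complex. y\<^sup>2 \<in> ?p ` ball x0 r}"
  have "open (?p ` ball x0 r)" by (rule open_mapping_thm3[OF holp open_ball r(2)])
  then have "open ((\<lambda>y::complex. y\<^sup>2) -` (?p ` ball x0 r))"
    by (intro open_vimage continuous_intros) auto
  then have D: "open D" by (simp add: D_def vimage_def)
  define W where "W = (\<lambda>y. (g (y\<^sup>2), y)) ` D"
  have W': "W = curve \<inter> {w. dist x0 (fst w) < r}"
  proof (intro set_eqI iffI)
    fix w assume "w \<in> W"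
    then obtain y where y: "y \<in> D" "w = (g (y\<^sup>2), y)" by (auto simp: W_def)
    then obtain x where x: "x \<in> ball x0 r" "y\<^sup>2 = ?p x" by (auto simp: D_def)
    then show "w \<in> curve \<inter> {w. dist x0 (fst w) < r}"
      using g(2)[of x] y by (auto simp: curve_def)
  next
    fix w assume w: "w \<in> curve \<inter> {w. dist x0 (fst w) < r}"
    obtain x y where xy: "w = (x, y)" by (cases w)
    have x: "x \<in> ball x0 r" "y\<^sup>2 = ?p x" using w by (auto simp: xy curve_def)
    then have "y \<in> D" "g (y\<^sup>2) = x" using g(2)[of x] by (auto simp: D_def)
    then show "w \<in> W" by (auto simp: W_def xy)
  qed
  have "open {w::complex \<times> complex. dist x0 (fst w) < r}"
    by (intro open_Collect_less continuous_intros)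
  then have open_W: "openin (top_of_set curve) W" unfolding W' by (rule openin_open_Int)
  have "(W, snd) \<in> coord_charts"
  proof (rule coord_chartI(1)[OF D _ _ _ _ W_def open_W])
    have "g \<circ> (\<lambda>y. y\<^sup>2) holomorphic_on D"
      by (rule holomorphic_on_compose_gen[OF _ g(1)])
         (auto simp: D_def intro!: holomorphic_intros)
    then show "(\<lambda>y. g (y\<^sup>2)) holomorphic_on D" by (simp add: o_def)
  qed auto
  moreover have "(x0, 0) \<in> W" using assms r by (simp add: W')
  ultimately show thesis by (rule that)
qed

lemma coord_chart_cover:
  assumes "w \<in> curve"
  obtains W k where "(W, k) \<in> coord_charts" "w \<in> W"
  using coord_chart_fst coord_chart_snd assms that by (metis prod.collapse)

section \<open>Transfer of charts from the affine curve to the glued surface\<close>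

lemma inv_side: "e \<in> sides \<Longrightarrow> w \<in> curve \<Longrightarrow> inv_into curve e (e w) = w"
  by (rule inv_into_f_f[OF inj_side])

lemma coord_chartD:
  assumes "(W, k) \<in> coord_charts"
  shows "openin (top_of_set curve) W" "k \<in> {fst, snd}" "inj_on k W" "open (k ` W)"
    "(\<lambda>z. fst (inv_into W k z)) holomorphic_on k ` W"
    "(\<lambda>z. snd (inv_into W k z)) holomorphic_on k ` W" "W \<subseteq> curve"
  using assms openin_subset[of "top_of_set curve" W] by (auto simp: coord_charts_def)

lemma chart_image:
  assumes "e \<in> sides" "A \<subseteq> curve"
  shows "(k \<circ> inv_into curve e) ` e ` A = k ` A"
  using inv_into_f_f[OF inj_side[OF assms(1)]] assms(2) by (force simp: image_iff)

lemma inv_into_chart: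
  assumes "e \<in> sides" "(W, k) \<in> coord_charts" "z \<in> k ` W"
  shows "inv_into (e ` W) (k \<circ> inv_into curve e) z = e (inv_into W k z)"
proof (rule inv_into_f_eq)
  note C = coord_chartD[OF assms(2)]
  have 1: "inv_into curve e (e w) = w" if "w \<in> W" for w
    using that C(7) by (intro inv_side assms(1)) blast
  show "inj_on (k \<circ> inv_into curve e) (e ` W)"
    using C(3) by (auto simp: inj_on_def 1)
  show "e (inv_into W k z) \<in> e ` W" using assms(3) by (auto intro: inv_into_into)
  show "(k \<circ> inv_into curve e) (e (inv_into W k z)) = z"
    using assms(3) 1[of "inv_into W k z"] by (simp add: inv_into_into f_inv_into_f)
qed

lemma complex_chart_surf:
  assumes e: "e \<in> sides" and W: "(W, k) \<in> coord_charts"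
  shows "complex_chart surf_top (e ` W, k \<circ> inv_into curve e)"
proof -
  note C = coord_chartD[OF W]
  have emb: "homeomorphic_map (top_of_set curve) (subtopology surf_top (e ` curve)) e"
    using embedding_side[OF e] by (simp add: embedding_map_def)
  have "homeomorphic_map (subtopology (top_of_set curve) W)
      (subtopology (subtopology surf_top (e ` curve)) (e ` W)) e"
    using C(7) side_in_surf[OF e] by (intro homeomorphic_map_subtopologies[OF emb]) auto
  moreover have "curve \<inter> W = W" "e ` curve \<inter> e ` W = e ` W" using C(7) by auto
  ultimately have "homeomorphic_map (top_of_set W) (subtopology surf_top (e ` W)) e"
    by (simp add: subtopology_subtopology)
  then obtain g where g: "homeomorphic_maps (top_of_set W) (subtopology surf_top (e ` W)) e g"
    by (auto simp: homeomorphic_map_maps)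
  have "homeomorphic_maps (top_of_set W) (top_of_set (k ` W)) k (inv_into W k)"
    unfolding homeomorphic_maps_def
  proof (intro conjI ballI)
    show "continuous_map (top_of_set W) (top_of_set (k ` W)) k"
      using C(2) by (auto intro!: continuous_intros)
    have "continuous_on (k ` W) (\<lambda>z. (fst (inv_into W k z), snd (inv_into W k z)))"
      by (intro continuous_on_Pair holomorphic_on_imp_continuous_on C)
    then show "continuous_map (top_of_set (k ` W)) (top_of_set W) (inv_into W k)"
      by (auto simp: inv_into_into)
  qed (auto simp: inv_into_f_f[OF C(3)] f_inv_into_f)
  with g have "homeomorphic_maps (subtopology surf_top (e ` W)) (top_of_set (k ` W)) (k \<circ> g)
      (e \<circ> inv_into W k)"
    using homeomorphic_maps_compose homeomorphic_maps_sym by blast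
  then have "homeomorphic_map (subtopology surf_top (e ` W)) (top_of_set (k ` W)) (k \<circ> g)"
    by (auto simp: homeomorphic_map_maps)
  moreover have "(k \<circ> g) q = (k \<circ> inv_into curve e) q" if q: "q \<in> e ` W" for q
  proof -
    obtain w where w: "w \<in> W" "q = e w" using q by auto
    then have "g q = w" using g by (auto simp: homeomorphic_maps_def)
    moreover have "inv_into curve e q = w" unfolding w(2) using w C(7) by (intro inv_side e) blast
    ultimately show ?thesis by simp
  qed
  ultimately have "homeomorphic_map (subtopology surf_top (e ` W)) (top_of_set (k ` W))
      (k \<circ> inv_into curve e)"
    using C(7) side_in_surf[OF e] by (elim homeomorphic_map_eq) auto
  then show ?thesis
    using C(4) open_side[OF e C(1)] 
    by (simp only: complex_chart_def prod.case chart_image[OF e C(7)] simp_thms)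
qed

lemma inv_side_side:
  assumes "e \<in> sides" "e' \<in> sides" "w \<in> curve" "e w \<in> e' ` A" "A \<subseteq> curve"
  shows "inv_into curve e' (e w) = trans_map e e' w" "trans_map e e' w \<in> A"
    "e' \<noteq> e \<longrightarrow> fst w \<noteq> 0"
proof -
  obtain w' where w': "w' \<in> A" "e w = e' w'" using assms(4) by auto
  then have *: "(e' \<noteq> e \<longrightarrow> fst w \<noteq> 0) \<and> w' = trans_map e e' w"
    using side_eq_side[OF assms(1-3), of w'] assms(5) by auto
  then show "e' \<noteq> e \<longrightarrow> fst w \<noteq> 0" "trans_map e e' w \<in> A" using w' by auto
  show "inv_into curve e' (e w) = trans_map e e' w"
    using inv_into_f_f[OF inj_side[OF assms(2)], of w'] w' assms(5) * by auto
qed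

text \<open>The target is any subset of the curve and not necessarily a chart domain, so the same
  statement also shows that the coordinate functions x and y are holomorphic on the whole affine
  part.\<close>

lemma chart_transition_holomorphic:
  assumes e: "e \<in> sides" "e' \<in> sides" and W: "(W, k) \<in> coord_charts"
    and W': "W' \<subseteq> curve" "k' \<in> {fst, snd}"
  shows "((k' \<circ> inv_into curve e') \<circ> inv_into (e ` W) (k \<circ> inv_into curve e)) holomorphic_on
    (k \<circ> inv_into curve e) ` (e ` W \<inter> e' ` W')"
proof -
  note C = coord_chartD[OF W]
  let ?\<gamma> = "inv_into W k"
  define D where "D = (k \<circ> inv_into curve e) ` (e ` W \<inter> e' ` W')"
  have inD: "z \<in> k ` W" "e (?\<gamma> z) \<in> e' ` W'" "?\<gamma> z \<in> curve" if "z \<in> D" for z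
  proof -
    from that[unfolded D_def] obtain q where q: "z = (k \<circ> inv_into curve e) q" "q \<in> e ` W \<inter> e' ` W'"
      by (rule imageE)
    from q(2) have "q \<in> e ` W" by simp
    then obtain w where w: "q = e w" "w \<in> W" by (rule imageE)
    have wc: "w \<in> curve" using w(2) C(7) by (rule rev_subsetD)
    have z: "z = k w" using q(1) inv_side[OF e(1) wc] by (simp add: w(1))
    have "?\<gamma> z = w" unfolding z by (rule inv_into_f_f[OF C(3) w(2)])
    then show "z \<in> k ` W" "e (?\<gamma> z) \<in> e' ` W'" "?\<gamma> z \<in> curve"
      using w wc z q(2) by simp_all
  qed
  have eq: "((k' \<circ> inv_into curve e') \<circ> inv_into (e ` W) (k \<circ> inv_into curve e)) z =
      k' (trans_map e e' (?\<gamma> z))" "e' \<noteq> e \<longrightarrow> fst (?\<gamma> z) \<noteq> 0" if "z \<in> D" for z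
    using inv_side_side[OF e inD(3)[OF that] inD(2)[OF that] W'(1)] inv_into_chart[OF e(1) W inD(1)[OF that]]
    by auto
  have hol: "(\<lambda>z. fst (?\<gamma> z)) holomorphic_on D" "(\<lambda>z. snd (?\<gamma> z)) holomorphic_on D"
    by (rule holomorphic_on_subset[OF C(5)] holomorphic_on_subset[OF C(6)], rule subsetI, erule inD(1))+
  have "(\<lambda>z. k' (trans_map e e' (?\<gamma> z))) holomorphic_on D"
  proof (cases "e' = e")
    case True
    then show ?thesis using W'(2) hol by (auto simp: trans_map_def)
  next
    case False
    then have nz: "fst (?\<gamma> z) \<noteq> 0" if "z \<in> D" for z using eq(2)[OF that] by simp
    have "(\<lambda>z. 1 / fst (?\<gamma> z)) holomorphic_on D"
      "(\<lambda>z. \<kappa> * snd (?\<gamma> z) / fst (?\<gamma> z) ^ n) holomorphic_on D" for \<kappa>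
      using hol nz by (auto intro!: holomorphic_intros)
    moreover obtain \<kappa> where "trans_map e e' = flip \<kappa>" using False by (simp add: trans_map_def)
    ultimately show ?thesis using W'(2) by (auto simp: flip_def case_prod_unfold)
  qed
  then show ?thesis unfolding D_def[symmetric] using eq(1) by (simp cong: holomorphic_cong)
qed

section \<open>Four closed discs: compactness and connectedness\<close>

definition sheet :: "complex \<Rightarrow> complex \<Rightarrow> complex \<times> complex" where
  "sheet s x = (x, s * \<i> * csqrt (1 - x ^ (2 * n)))"

lemma sheet_curve: "s\<^sup>2 = 1 \<Longrightarrow> sheet s x \<in> curve"
  by (simp add: sheet_def curve_def power_mult_distrib)

lemma curve_sheet:
  assumes "(x, y) \<in> curve"
  obtains s where "s \<in> {1, -1}" "(x, y) = sheet s x"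
proof -
  have "y\<^sup>2 = (\<i> * csqrt (1 - x ^ (2 * n)))\<^sup>2"
    using assms by (simp add: curve_def power_mult_distrib)
  then have "y = \<i> * csqrt (1 - x ^ (2 * n)) \<or> y = - (\<i> * csqrt (1 - x ^ (2 * n)))"
    by (simp only: power2_eq_iff)
  then show thesis using that[of 1] that[of "-1"] by (auto simp: sheet_def)
qed

text \<open>On the closed unit disc |x^(2n)| \<le> 1 puts 1 - x^(2n) into the closed right
  half-plane. For this reason \<open>sheet\<close> takes i times the root of 1 - x^(2n) in place of
  the root of x^(2n) - 1.\<close>

lemma continuous_sheet: "continuous_on (cball 0 1) (sheet s)"
proof -
  have "continuous_on (cball 0 1) (\<lambda>x::complex. csqrt (1 - x ^ (2 * n)))"
  proof (rule continuous_on_compose2[OF continuous_on_csqrt_right_half_plane])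
    show "(\<lambda>x::complex. 1 - x ^ (2 * n)) ` cball 0 1 \<subseteq> {z. 0 \<le> Re z}"
    proof safe
      fix x :: complex assume "x \<in> cball 0 1"
      then have "cmod (x ^ (2 * n)) \<le> 1" by (simp add: norm_power power_le_one)
      then show "0 \<le> Re (1 - x ^ (2 * n))" using complex_Re_le_cmod[of "x ^ (2 * n)"] by simp
    qed
  qed (intro continuous_intros)
  then show ?thesis unfolding sheet_def by (intro continuous_intros)
qed

definition disc_map :: "(complex \<times> complex \<Rightarrow> point) \<Rightarrow> complex \<Rightarrow> complex \<Rightarrow> point" where
  "disc_map e s x = e (sheet s x)"

lemma continuous_disc_map:
  assumes "e \<in> sides" "s \<in> {1, -1}"
  shows "continuous_map (top_of_set (cball 0 1)) surf_top (disc_map e s)"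
proof -
  have "continuous_map (top_of_set (cball 0 1)) (top_of_set curve) (sheet s)"
    using continuous_sheet sheet_curve assms(2) by (auto simp: continuous_map_in_subtopology)
  from continuous_map_compose[OF this continuous_side[OF assms(1)]]
  show ?thesis by (simp add: o_def disc_map_def[abs_def])
qed

lemma surf_points_discs: "surf_points = (\<Union>e\<in>sides. \<Union>s\<in>{1, -1}. disc_map e s ` cball 0 1)"
proof
  show "surf_points \<subseteq> (\<Union>e\<in>sides. \<Union>s\<in>{1, -1}. disc_map e s ` cball 0 1)"
  proof
    fix q assume "q \<in> surf_points"
    then obtain e x y where q: "e \<in> sides" "(x, y) \<in> curve" "cmod x \<le> 1" "q = e (x, y)"
      using surf_points_cases by metis
    obtain s where "s \<in> {1, -1}" "(x, y) = sheet s x" using curve_sheet[OF q(2)] .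
    then show "q \<in> (\<Union>e\<in>sides. \<Union>s\<in>{1, -1}. disc_map e s ` cball 0 1)"
      using q by (force simp: disc_map_def)
  qed
  show "(\<Union>e\<in>sides. \<Union>s\<in>{1, -1}. disc_map e s ` cball 0 1) \<subseteq> surf_points"
    by (intro UN_least image_subsetI, unfold disc_map_def, rule side_in_surf[OF _ sheet_curve]) auto
qed

lemma compact_surf: "compact_space surf_top"
proof -
  have "compactin surf_top (disc_map e s ` cball 0 1)" if "e \<in> sides" "s \<in> {1, -1}" for e s
    by (rule image_compactin[OF _ continuous_disc_map[OF that]])
       (simp add: compactin_subtopology)
  then have "compactin surf_top (\<Union>e\<in>sides. \<Union>s\<in>{1, -1}. disc_map e s ` cball 0 1)"
    by (intro compactin_Union) (auto simp: sides_def intro!: compactin_Un)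
  then show ?thesis by (simp add: compact_space_def surf_points_discs)
qed

text \<open>The branch point (1, 0) is fixed by the gluing and lies on both sheets; it is the common
  point that connects the four discs.\<close>

lemma disc_map_1: "e \<in> sides \<Longrightarrow> disc_map e s 1 = Inl (1, 0)"
  by (auto simp: disc_map_def sheet_def sides_def at_inf_def flip_def)

lemma connected_surf: "connected_space surf_top"
proof -
  let ?\<U> = "(\<lambda>(e, s). disc_map e s ` cball 0 1) ` (sides \<times> {1, -1})"
  have "connectedin surf_top (\<Union>?\<U>)"
  proof (rule connectedin_Union)
    fix A assume "A \<in> ?\<U>"
    then obtain e s where es: "e \<in> sides" "s \<in> {1, -1}" "A = disc_map e s ` cball 0 1" by auto
    show "connectedin surf_top A" unfolding es(3)
      by (rule connectedin_continuous_map_image[OF continuous_disc_map[OF es(1,2)]])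
         (auto simp: connectedin_subtopology convex_connected)
  next
    have "Inl (1, 0) \<in> \<Inter>?\<U>"
      by (auto intro!: image_eqI[of _ _ 1] simp: disc_map_1)
    then show "\<Inter>?\<U> \<noteq> {}" by blast
  qed
  also have "\<Union>?\<U> = surf_points" by (auto simp: surf_points_discs)
  finally show ?thesis using connectedin_topspace[of surf_top] by simp
qed

lemma closed_riemann_surface_surf: "closed_riemann_surface surf"
  unfolding closed_riemann_surface_def rs_topology_surf topspace_surf
proof (intro conjI compact_surf connected_surf Hausdorff_surf)
  show "surf_points \<noteq> {}" using disc_map_1[of Inl 1] by (auto simp: surf_points_discs sides_def)
  show "\<forall>c\<in>rs_atlas surf. complex_chart surf_top c"
    using complex_chart_surf by (auto simp: surf_def)
  show "(\<Union>(U, h)\<in>rs_atlas surf. U) = surf_points"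
  proof
    show "(\<Union>(U, h)\<in>rs_atlas surf. U) \<subseteq> surf_points"
      using coord_chartD(7) side_in_surf by (fastforce simp: surf_def)
    show "surf_points \<subseteq> (\<Union>(U, h)\<in>rs_atlas surf. U)"
    proof
      fix q assume "q \<in> surf_points"
      then obtain e w where q: "e \<in> sides" "w \<in> curve" "q = e w"
        by (auto simp: surf_points_def sides_def)
      obtain W k where "(W, k) \<in> coord_charts" "w \<in> W" using coord_chart_cover[OF q(2)] .
      then have "(e ` W, k \<circ> inv_into curve e) \<in> rs_atlas surf" "q \<in> e ` W"
        using q by (auto simp: surf_def)
      then show "q \<in> (\<Union>(U, h)\<in>rs_atlas surf. U)" by blast
    qed
  qed
  show "\<forall>(U, h)\<in>rs_atlas surf. \<forall>(V, k)\<in>rs_atlas surf. (k \<circ> inv_into U h) holomorphic_on h ` (U \<inter> V)"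
  proof clarify
    fix U h V k assume "(U, h) \<in> rs_atlas surf" "(V, k) \<in> rs_atlas surf"
    then show "(k \<circ> inv_into U h) holomorphic_on h ` (U \<inter> V)"
      by (elim atlas_cases) (simp only: chart_transition_holomorphic coord_chartD)
  qed
qed

end

section \<open>Genus and hyperellipticity\<close>

context hyperelliptic_gluing
begin

section \<open>The unit circle and the roots of unity\<close>

definition circ :: "real \<Rightarrow> complex" where
  "circ \<tau> = cis (pi * \<tau> / n)"

lemma norm_circ [simp]: "cmod (circ \<tau>) = 1"
  by (simp add: circ_def)

lemma circ_inj:
  assumes "circ \<tau> = circ \<tau>'" "0 \<le> \<tau>" "\<tau> < 2 * real n" "0 \<le> \<tau>'" "\<tau>' < 2 * real n"
  shows "\<tau> = \<tau>'"
proof -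
  have *: "Arg2pi (circ t) = pi * t / n" if "0 \<le> t" "t < 2 * real n" for t
  proof (rule Arg2pi_unique)
    show "of_real 1 * exp (\<i> * of_real (pi * t / n)) = circ t"
      by (simp add: circ_def cis_conv_exp)
    have "pi * t < pi * (2 * real n)" using that by simp
    then show "pi * t / n < 2 * pi" using n_ge_2 by (simp add: pos_divide_less_eq mult_ac)
  qed (use that in auto)
  have "pi * \<tau> / n = Arg2pi (circ \<tau>)" using *[OF assms(2,3)] by (rule sym)
  also have "\<dots> = pi * \<tau>' / n" unfolding assms(1) by (rule *[OF assms(4,5)])
  finally show ?thesis using n_ge_2 by simp
qed

lemma circ_surj:
  assumes "cmod x = 1"
  obtains k t where "k < 2 * n" "0 \<le> t" "t < 1" "x = circ (real k + t)"
proof -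
  define \<tau> where "\<tau> = Arg2pi x * n / pi"
  have x: "x = circ \<tau>"
    using Arg2pi_eq[of x] assms n_ge_2 unfolding \<tau>_def circ_def cis_conv_exp by simp
  have \<tau>: "0 \<le> \<tau>" "\<tau> < 2 * real n"
    using Arg2pi_ge_0[of x] Arg2pi_lt_2pi[of x] n_ge_2 by (auto simp: \<tau>_def pos_divide_less_eq)
  show thesis
  proof (rule that[of "nat \<lfloor>\<tau>\<rfloor>" "frac \<tau>"])
    show "nat \<lfloor>\<tau>\<rfloor> < 2 * n" using \<tau> by linarith
    show "x = circ (real (nat \<lfloor>\<tau>\<rfloor>) + frac \<tau>)" using x \<tau> by (simp add: frac_def)
  qed (auto simp: frac_ge_0 frac_lt_1)
qed

lemma circ_power: "circ \<tau> ^ (2 * n) = cis (2 * pi * \<tau>)"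
proof -
  have "real (2 * n) * (pi * \<tau> / real n) = 2 * pi * \<tau>" using n_ge_2 by (simp add: field_simps)
  then show ?thesis by (simp only: circ_def Complex.DeMoivre)
qed

lemma circ_nat_power: "circ (real j) ^ (2 * n) = 1"
  unfolding circ_power by (simp add: cis_multiple_2pi)

lemma circ_wrap: "circ (real (2 * n)) = circ 0"
  using n_ge_2 by (simp add: circ_def cis.ctr complex_eq_iff)

lemma bij_circ_roots: "bij_betw (\<lambda>j. circ (real j)) {..<2 * n} {x. x ^ (2 * n) = 1}"
proof -
  have "bij_betw (\<lambda>k. cis (2 * pi * real k / real (2 * n))) {..<2 * n} {z. z ^ (2 * n) = 1}"
    by (rule Complex.bij_betw_roots_unity) (use n_ge_2 in simp)
  then show ?thesis using n_ge_2 by (simp add: circ_def)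
qed

lemma circ_power_neq_1:
  assumes "k < 2 * n" "0 < t" "t < 1"
  shows "circ (real k + t) ^ (2 * n) \<noteq> 1"
proof
  assume "circ (real k + t) ^ (2 * n) = 1"
  then obtain j where j: "j < 2 * n" "circ (real k + t) = circ (real j)"
    using bij_circ_roots by (auto simp: bij_betw_def)
  have "real k + t = real j" by (rule circ_inj[OF j(2)]) (use assms j in linarith)+
  then have "real k < real j" "real j < real (Suc k)" using assms by linarith+
  then have "k < j" "j < Suc k" by (simp_all only: of_nat_less_iff)
  then show False by linarith
qed

text \<open>Points of different copies are identified only if x * x' = 1, so inside the closed discs
  only along the unit circle. Within one copy the two sheets meet only where the square root
  vanishes.\<close>

lemma disc_map_eq:
  assumes e: "e \<in> sides" "e' \<in> sides" and s: "s \<in> {1, -1}" "s' \<in> {1, -1}"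
    and x: "cmod x \<le> 1" "cmod x' \<le> 1" and eq: "disc_map e s x = disc_map e' s' x'"
  shows "e \<noteq> e' \<Longrightarrow> cmod x = 1 \<and> cmod x' = 1"
    and "e = e' \<Longrightarrow> x = x' \<and> (s = s' \<or> x ^ (2 * n) = 1)"
proof -
  have c: "sheet s x \<in> curve" "sheet s' x' \<in> curve" using s by (auto intro!: sheet_curve)
  have *: "(e' \<noteq> e \<longrightarrow> x \<noteq> 0) \<and> sheet s' x' = trans_map e e' (sheet s x)"
    using side_eq_side[OF e c] eq by (simp add: disc_map_def sheet_def)
  show "e = e' \<Longrightarrow> x = x' \<and> (s = s' \<or> x ^ (2 * n) = 1)"
    using * s by (auto simp: trans_map_def sheet_def)
  assume "e \<noteq> e'"
  then have "x \<noteq> 0" "fst (sheet s' x') = fst (trans_map e e' (sheet s x))" using * by auto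
  then have "x' * x = 1" using \<open>e \<noteq> e'\<close> by (simp add: trans_map_def) (simp add: sheet_def)
  then have p: "cmod x' * cmod x = 1" by (metis norm_mult norm_one)
  have "cmod x' * cmod x \<le> cmod x'" "cmod x' * cmod x \<le> cmod x"
    using x by (auto intro: mult_left_le mult_left_le_one_le)
  then show "cmod x = 1 \<and> cmod x' = 1" using x p by auto
qed

text \<open>Inverting x preserves the unit circle, so the boundaries of the discs of the second copy
  are already present in the first. The 1-skeleton can therefore be indexed by \<open>Inl\<close>
  alone.\<close>

lemma disc_map_circle:
  assumes "e \<in> sides" "s \<in> {1, -1}" "cmod x = 1"
  obtains s' x' where "s' \<in> {1, -1}" "cmod x' = 1" "disc_map e s x = disc_map Inl s' x'"
proof (cases "e = Inl")
  case True
  then show ?thesis using that assms by auto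
next
  case False
  then have e: "e = at_inf" using assms by (auto simp: sides_def)
  let ?w = "flip \<i> (sheet s x)"
  have x: "x \<noteq> 0" using assms by auto
  then have "?w \<in> curve" using assms by (intro flip_curve sheet_curve) (auto simp: sheet_def)
  then obtain s' where s': "s' \<in> {1, -1}" "?w = sheet s' (fst ?w)"
    using curve_sheet[of "fst ?w" "snd ?w"] by (metis fst_conv prod.collapse sheet_def)
  have "disc_map e s x = Inl ?w" using x by (simp add: disc_map_def e at_inf_def sheet_def)
  also have "\<dots> = disc_map Inl s' (fst ?w)" unfolding disc_map_def using s'(2) by (rule arg_cong)
  finally show ?thesis using s'(1) assms(3) by (intro that) (auto simp: norm_divide sheet_def)
qed

text \<open>A cell is a triple \<open>(e, s, A)\<close>, standing for the image of \<open>A\<close> under \<^term>\<open>disc_map e s\<close>.\<close>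

definition circle_arc :: "nat \<Rightarrow> complex set" where
  "circle_arc k = (\<lambda>t. circ (real k + t)) ` {0<..<1}"

text \<open>The labels \<open>Inl\<close> and \<open>1\<close> are normal forms: the two sheets meet
  at a branch point, and the second copy contributes no new one. Further labels would count a vertex
  more than once.\<close>

definition vertices :: "((complex \<times> complex \<Rightarrow> point) \<times> complex \<times> complex set) set" where
  "vertices = (\<lambda>j. (Inl, 1, {circ (real j)})) ` {..<2 * n}"

definition edges :: "((complex \<times> complex \<Rightarrow> point) \<times> complex \<times> complex set) set" where
  "edges = (\<lambda>(k, s). (Inl, s, circle_arc k)) ` ({..<2 * n} \<times> {1, -1})"

definition faces :: "((complex \<times> complex \<Rightarrow> point) \<times> complex \<times> complex set) set" where
  "faces = (\<lambda>(e, s). (e, s, ball 0 1)) ` (sides \<times> {1, -1})"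

definition cell :: "(complex \<times> complex \<Rightarrow> point) \<times> complex \<times> complex set \<Rightarrow> point set" where
  "cell = (\<lambda>(e, s, A). disc_map e s ` A)"

lemma arc_inter:
  assumes "k < 2 * n" "k' < 2 * n" "x \<in> circle_arc k" "x \<in> circle_arc k'"
  shows "k = k'"
proof -
  obtain t t' where t: "0 < t" "t < 1" "0 < t'" "t' < 1" "circ (real k + t) = circ (real k' + t')"
    using assms(3,4) by (auto simp: circle_arc_def)
  have "real k + t = real k' + t'" by (rule circ_inj[OF t(5)]) (use assms t in linarith)+
  then show ?thesis using t by linarith
qed

text \<open>The coordinate x reveals the dimension of the cell: |x| < 1 on faces, and on the circle
  x^(2n) = 1 at vertices only. Given the dimension, \<open>disc_map_eq\<close> fixes copy, sheet and
  position. Comparing labels and not sets yields disjointness as well as the injectivity needed for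
  counting.\<close>

lemma cells_disjoint:
  assumes "i \<in> vertices \<union> edges \<union> faces" "i' \<in> vertices \<union> edges \<union> faces"
    "q \<in> cell i" "q \<in> cell i'"
  shows "i = i'"
proof -
  have cases: "(e \<in> sides \<and> s \<in> {1, -1} \<and> A = ball 0 1) \<or>
      (e = Inl \<and> s = 1 \<and> (\<exists>j<2*n. A = {circ (real j)})) \<or>
      (e = Inl \<and> s \<in> {1, -1} \<and> (\<exists>k<2*n. A = circle_arc k))"
    if "(e, s, A) \<in> vertices \<union> edges \<union> faces" for e s A
    using that by (auto simp: vertices_def edges_def faces_def)
  obtain e s A where i: "i = (e, s, A)" by (cases i)
  obtain e' s' A' where i': "i' = (e', s', A')" by (cases i')
  obtain x where x: "x \<in> A" "q = disc_map e s x" using assms(3) by (auto simp: i cell_def)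
  obtain x' where x': "x' \<in> A'" "q = disc_map e' s' x'" using assms(4) by (auto simp: i' cell_def)
  note c = cases[OF assms(1)[unfolded i]] and c' = cases[OF assms(2)[unfolded i']]
  have es: "e \<in> sides" "s \<in> {1, -1}" "e' \<in> sides" "s' \<in> {1, -1}"
    using c c' by (auto simp: sides_def)
  have nx: "cmod x \<le> 1" "cmod x' \<le> 1" using c c' x x' by (auto simp: circle_arc_def)
  note eq = disc_map_eq[OF es(1,3,2,4) nx]
  have ball: "cmod y < 1 \<longleftrightarrow> B = ball 0 1"
    if "(d, r, B) \<in> vertices \<union> edges \<union> faces" "y \<in> B" for d r B y
  proof -
    have "cmod z = 1" if "z \<in> B" "B \<noteq> ball 0 1" for z
      using cases[OF \<open>(d, r, B) \<in> _\<close>] that by (auto simp: circle_arc_def)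
    then show ?thesis using that by fastforce
  qed
  have A: "cmod x < 1 \<longleftrightarrow> A = ball 0 1" "cmod x' < 1 \<longleftrightarrow> A' = ball 0 1"
    using ball[OF assms(1)[unfolded i] x(1)] ball[OF assms(2)[unfolded i'] x'(1)] by auto
  have not_ball: "B \<noteq> ball 0 1" if "B = {circ (real j)} \<or> B = circle_arc j" for B j
  proof -
    have "circ (real j) \<notin> ball 0 1" "circ (real j + 1/2) \<notin> ball 0 1" by simp_all
    moreover have "circ (real j + 1/2) \<in> circle_arc j" by (auto simp: circle_arc_def)
    ultimately show ?thesis using that by (metis insertI1)
  qed
  show ?thesis
  proof (cases "A = ball 0 1 \<or> A' = ball 0 1")
    case True
    then have lt: "cmod x < 1 \<or> cmod x' < 1" using A by auto
    then have "e = e'" using eq(1) x x' by force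
    then have xx: "x = x'" "s = s' \<or> x ^ (2 * n) = 1" using eq(2) x x' by auto
    have "cmod x < 1" using lt xx by auto
    then have "cmod (x ^ (2 * n)) < 1" using n_ge_2 by (simp add: norm_power power_less_one_iff)
    then have "s = s'" using xx by auto
    then show ?thesis using \<open>e = e'\<close> xx A \<open>cmod x < 1\<close> by (simp add: i i')
  next
    case False
    then have e: "e = Inl" "e' = Inl" using c c' by auto
    then have xx: "x = x'" "s = s' \<or> x ^ (2 * n) = 1" using eq(2) x x' by auto
    have arc1: "y ^ (2 * n) \<noteq> 1" if "y \<in> circle_arc k" "k < 2 * n" for y k
      using that circ_power_neq_1 by (auto simp: circle_arc_def)
    have "(s = 1 \<and> (\<exists>j<2*n. A = {circ (real j)}) \<and> x ^ (2 * n) = 1) \<or>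
      ((\<exists>k<2*n. A = circle_arc k) \<and> x ^ (2 * n) \<noteq> 1)"
      using c False x arc1 circ_nat_power by auto
    moreover have "(s' = 1 \<and> (\<exists>j<2*n. A' = {circ (real j)}) \<and> x ^ (2 * n) = 1) \<or>
      ((\<exists>k<2*n. A' = circle_arc k) \<and> x ^ (2 * n) \<noteq> 1)"
      unfolding xx(1) using c' False x' arc1 circ_nat_power by auto
    ultimately have "s = s' \<and> A = A'"
      using xx x x' arc_inter by auto
    then show ?thesis by (simp add: i i' e)
  qed
qed

lemma circle_covered:
  assumes "e \<in> sides" "s \<in> {1, -1}" "cmod x = 1"
  shows "disc_map e s x \<in> \<Union> (cell ` (vertices \<union> edges))"
proof -
  obtain s' x' where s': "s' \<in> {1, -1}" "cmod x' = 1" "disc_map e s x = disc_map Inl s' x'"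
    using disc_map_circle[OF assms] by metis
  obtain k t where k: "k < 2 * n" "0 \<le> t" "t < 1" "x' = circ (real k + t)"
    using circ_surj[OF s'(2)] by metis
  show ?thesis
  proof (cases "t = 0")
    case True
    then have "x' ^ (2 * n) = 1" using k circ_nat_power by simp
    then have "disc_map e s x \<in> cell (Inl, 1, {x'})"
      using s' by (simp add: cell_def disc_map_def sheet_def)
    then show ?thesis using True k by (auto simp: vertices_def)
  next
    case False
    then have "disc_map e s x \<in> cell (Inl, s', circle_arc k)"
      using s' k by (auto simp: cell_def circle_arc_def)
    then show ?thesis using s' k by (auto simp: edges_def)
  qed
qed

lemma cells_cover: "\<Union> (cell ` (vertices \<union> edges \<union> faces)) = surf_points"
proof
  show "surf_points \<subseteq> \<Union> (cell ` (vertices \<union> edges \<union> faces))"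
  proof
    fix q assume "q \<in> surf_points"
    then obtain e s x where q: "e \<in> sides" "s \<in> {1, -1}" "cmod x \<le> 1" "q = disc_map e s x"
      unfolding surf_points_discs by (elim UN_E imageE) (simp only: mem_cball_0)
    show "q \<in> \<Union> (cell ` (vertices \<union> edges \<union> faces))"
    proof (cases "cmod x = 1")
      case True
      then show ?thesis using circle_covered[OF q(1,2) True] q(4) by auto
    next
      case False
      then have "q \<in> cell (e, s, ball 0 1)" using q by (auto simp: cell_def)
      then show ?thesis using q by (auto simp: faces_def)
    qed
  qed
  have "disc_map e s x \<in> surf_points" if "e \<in> sides" "s \<in> {1, -1}" for e s x
    unfolding disc_map_def by (rule side_in_surf[OF that(1) sheet_curve]) (use that in auto)
  then show "\<Union> (cell ` (vertices \<union> edges \<union> faces)) \<subseteq> surf_points"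
    by (force simp: vertices_def edges_def faces_def cell_def sides_def)
qed

lemma cells_nonempty: "i \<in> vertices \<union> edges \<union> faces \<Longrightarrow> cell i \<noteq> {}"
  by (auto simp: vertices_def edges_def faces_def cell_def circle_arc_def)

lemma inj_cell: "inj_on cell (vertices \<union> edges \<union> faces)"
proof (rule inj_onI)
  fix i i' assume i: "i \<in> vertices \<union> edges \<union> faces" "i' \<in> vertices \<union> edges \<union> faces"
    and eq: "cell i = cell i'"
  obtain q where "q \<in> cell i" using cells_nonempty[OF i(1)] by blast
  then show "i = i'" using cells_disjoint[OF i] eq by simp
qed

lemma finite_sides: "finite sides" and card_sides: "card sides = 2"
  using Inl_neq_at_inf by (simp_all add: sides_def)

lemma card_cells:
  "card vertices = 2 * n" "card edges = 4 * n" "card faces = 4"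
proof -
  have "inj_on (\<lambda>j. (Inl :: _ \<Rightarrow> point, 1::complex, {circ (real j)})) {..<2 * n}"
    using bij_circ_roots by (auto simp: bij_betw_def inj_on_def)
  then show "card vertices = 2 * n" unfolding vertices_def by (subst card_image) auto
  have "inj_on (\<lambda>(k, s). (Inl :: _ \<Rightarrow> point, s, circle_arc k)) ({..<2 * n} \<times> {1, -1})"
  proof -
    have "k = k'" if "k < 2 * n" "k' < 2 * n" "circle_arc k = circle_arc k'" for k k'
    proof -
      have "circ (real k + 1/2) \<in> circle_arc k" by (auto simp: circle_arc_def)
      then show "k = k'" using arc_inter[OF that(1,2)] that(3) by blast
    qed
    then show ?thesis by (auto simp: inj_on_def)
  qed
  then show "card edges = 4 * n" unfolding edges_def by (subst card_image) (auto simp: card_cartesian_product)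
  have "inj_on (\<lambda>(e, s). (e, s, ball 0 1 :: complex set)) (sides \<times> {1, -1::complex})"
    by (auto simp: inj_on_def)
  then show "card faces = 4" unfolding faces_def
    by (subst card_image) (auto simp: card_cartesian_product card_sides)
qed

lemma edge_map:
  assumes k: "k < 2 * n" and s: "s \<in> {1, -1}"
  defines "f \<equiv> \<lambda>t. disc_map Inl s (circ (real k + t))"
  shows "continuous_map (top_of_set {0..1}) surf_top f" "inj_on f {0<..<1}"
    "f ` {0<..<1} = cell (Inl, s, circle_arc k)" "f ` {0, 1} \<subseteq> \<Union> (cell ` vertices)"
proof -
  have Inl: "Inl \<in> sides" by (simp add: sides_def)
  have "continuous_map (top_of_set {0..1::real}) (top_of_set (cball 0 1)) (\<lambda>t. circ (real k + t))"
    using n_ge_2 by (auto simp: circ_def intro!: continuous_intros)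
  from continuous_map_compose[OF this continuous_disc_map[OF Inl s]]
  show "continuous_map (top_of_set {0..1}) surf_top f" by (simp add: f_def o_def)
  show "inj_on f {0<..<1}"
  proof (rule inj_onI)
    fix t t' assume t: "t \<in> {0<..<1}" "t' \<in> {0<..<1}" "f t = f t'"
    have "circ (real k + t) = circ (real k + t')"
      using disc_map_eq(2)[OF Inl Inl s s _ _ t(3)[unfolded f_def]] by simp
    then have "real k + t = real k + t'" by (rule circ_inj) (use t k in auto)
    then show "t = t'" by simp
  qed
  show "f ` {0<..<1} = cell (Inl, s, circle_arc k)" by (simp add: f_def cell_def circle_arc_def image_image)
  \<comment> \<open>Since y = 0 over a root of unity, the arcs of both sheets have the same
    endpoints, and the vertex label 1 serves for either \<open>s\<close>.\<close>
  have "disc_map Inl s (circ (real j)) = disc_map Inl 1 (circ (real j))" for j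
    using circ_nat_power[of j] by (simp add: disc_map_def sheet_def)
  moreover have "disc_map Inl 1 (circ (real j)) \<in> \<Union> (cell ` vertices)" if "j < 2 * n" for j
    using that by (auto simp: vertices_def cell_def)
  \<comment> \<open>The last arc, k = 2n - 1, ends at the parameter 2n, which is vertex 0
    again.\<close>
  moreover have "circ (real k + 1) = circ (real (if Suc k = 2 * n then 0 else Suc k))"
    using circ_wrap by (cases "Suc k = 2 * n") (simp_all add: add.commute flip: of_nat_Suc)
  ultimately show "f ` {0, 1} \<subseteq> \<Union> (cell ` vertices)"
    using k n_ge_2 unfolding f_def by (smt (verit) Suc_lessI add_0_right empty_iff image_iff insert_iff subsetI less_le_trans zero_less_Suc mult_pos_pos pos2)
qed

lemma cell_decomposition_surf:
  "cell_decomposition surf_top (cell ` vertices) (cell ` edges) (cell ` faces)"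
  unfolding cell_decomposition_def
proof (intro conjI ballI)
  have Inl: "Inl \<in> sides" by (simp add: sides_def)
  show "finite (cell ` vertices)" "finite (cell ` edges)" "finite (cell ` faces)"
    by (auto simp: vertices_def edges_def faces_def finite_sides)
  show "partition_on (topspace surf_top) (cell ` vertices \<union> cell ` edges \<union> cell ` faces)"
  proof (rule partition_onI)
    show "\<Union> (cell ` vertices \<union> cell ` edges \<union> cell ` faces) = topspace surf_top"
      using cells_cover by (simp add: image_Un)
  next
    show "disjnt p p'" if p: "p \<in> cell ` vertices \<union> cell ` edges \<union> cell ` faces"
      "p' \<in> cell ` vertices \<union> cell ` edges \<union> cell ` faces" "p \<noteq> p'" for p p'
    proof -
      obtain i i' where "i \<in> vertices \<union> edges \<union> faces" "p = cell i"
        "i' \<in> vertices \<union> edges \<union> faces" "p' = cell i'"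
        using p(1,2) unfolding image_Un[symmetric] by (elim imageE)
      then show ?thesis using cells_disjoint[of i i'] p(3) unfolding disjnt_iff by blast
    qed
  next
    show "{} \<notin> cell ` vertices \<union> cell ` edges \<union> cell ` faces"
      using cells_nonempty by fastforce
  qed
  show "\<exists>v. c = {v}" if "c \<in> cell ` vertices" for c
    using that by (auto simp: vertices_def cell_def)
  show "\<exists>e. continuous_map (top_of_set {0..1::real}) surf_top e \<and> inj_on e {0<..<1} \<and>
      e ` {0<..<1} = c \<and> e ` {0, 1} \<subseteq> \<Union> (cell ` vertices)" if c: "c \<in> cell ` edges" for c
  proof -
    obtain k s where "k < 2 * n" "s \<in> {1, -1}" "c = cell (Inl, s, circle_arc k)"
      using c by (auto simp: edges_def)
    then show ?thesis using edge_map[of k s] by blast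
  qed
  show "\<exists>f. continuous_map (top_of_set (cball 0 1::complex set)) surf_top f \<and> inj_on f (ball 0 1) \<and>
      f ` ball 0 1 = c \<and> f ` sphere 0 1 \<subseteq> \<Union> (cell ` vertices \<union> cell ` edges)" if c: "c \<in> cell ` faces" for c
  proof -
    obtain e s where es: "e \<in> sides" "s \<in> {1, -1}" "c = cell (e, s, ball 0 1)"
      using c by (auto simp: faces_def)
    have "inj_on (disc_map e s) (ball 0 1)"
      using disc_map_eq(2)[OF es(1,1,2,2)] by (auto simp: inj_on_def)
    moreover have "disc_map e s ` sphere 0 1 \<subseteq> \<Union> (cell ` vertices \<union> cell ` edges)"
      unfolding image_Un[symmetric] by (intro image_subsetI circle_covered es) simp
    ultimately show ?thesis
      using continuous_disc_map[OF es(1,2)] es(3) by (intro exI[of _ "disc_map e s"]) (auto simp: cell_def)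
  qed
qed

text \<open>With 2n vertices, 4n edges and 4 faces the Euler characteristic is 4 - 2n = 2 - 2(n -
  1).\<close>

lemma has_genus_surf: "has_genus surf (n - 1)"
proof -
  have "inj_on cell vertices" "inj_on cell edges" "inj_on cell faces"
    by (rule inj_on_subset[OF inj_cell], blast)+
  then have "card (cell ` vertices) = 2 * n" "card (cell ` edges) = 4 * n" "card (cell ` faces) = 4"
    by (simp_all add: card_image card_cells)
  then have "int (card (cell ` vertices)) - int (card (cell ` edges)) + int (card (cell ` faces)) =
      2 - 2 * int (n - 1)"
    using n_ge_2 by simp
  then show ?thesis
    unfolding has_genus_def rs_topology_surf using cell_decomposition_surf by blast
qed

section \<open>The affine equation in factored form\<close>

lemma roots_of_unity_prod: "(\<Prod>j<2 * n. x - circ (real j)) = x ^ (2 * n) - 1"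
proof -
  let ?P = "monom 1 (2 * n) - 1 :: complex poly" and ?Q = "\<Prod>j<2 * n. [:- circ (real j), 1:]"
  have degQ: "degree ?Q = 2 * n" by (simp add: degree_prod_eq_sum_degree)
  have "lead_coeff ?Q = 1" by (simp add: lead_coeff_prod)
  then have cQ: "coeff ?Q (2 * n) = 1" by (simp only: degQ)
  have n: "2 * n > 0" using n_ge_2 by simp
  have "?P = ?Q"
  \<comment> \<open>Both polynomials are monic of degree 2n, so their difference has smaller degree;
    agreement at the 2n roots of unity makes it zero.\<close>
  proof (rule poly_eqI_degree_lead_coeff)
    show "coeff ?P (2 * n) = coeff ?Q (2 * n)" using n cQ by (simp add: coeff_1)
    show "2 * n \<le> card {x::complex. x ^ (2 * n) = 1}" using card_roots_unity_eq[OF n] by simp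
    show "degree ?P \<le> 2 * n" by (intro degree_diff_le degree_monom_le) simp
    show "degree ?Q \<le> 2 * n" by (simp only: degQ)
    fix x :: complex assume x: "x \<in> {x. x ^ (2 * n) = 1}"
    then have "x \<in> (\<lambda>j. circ (real j)) ` {..<2 * n}" using bij_circ_roots by (simp add: bij_betw_def)
    then show "poly ?P x = poly ?Q x" using x by (auto simp: poly_monom poly_prod)
  qed
  then have "poly ?P x = poly ?Q x" by simp
  then show ?thesis by (simp add: poly_monom poly_prod)
qed

lemma homeomorphic_affine_part:
  "homeomorphic_map (subtopology surf_top (Inl ` curve)) (top_of_set curve) (inv_into curve Inl)"
proof -
  have Inl: "Inl \<in> sides" by (simp add: sides_def)
  obtain g where g: "homeomorphic_maps (top_of_set curve) (subtopology surf_top (Inl ` curve)) Inl g"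
    using embedding_side[OF Inl] by (auto simp: embedding_map_def homeomorphic_map_maps)
  then have "homeomorphic_map (subtopology surf_top (Inl ` curve)) (top_of_set curve) g"
    using homeomorphic_map_maps homeomorphic_maps_sym by blast
  moreover have "g q = inv_into curve Inl q" if "q \<in> Inl ` curve" for q
    using g that inv_side[OF Inl] by (auto simp: homeomorphic_maps_def)
  ultimately show ?thesis by (elim homeomorphic_map_eq) auto
qed

lemma hyperelliptic_surf: "hyperelliptic surf (n - 1)"
proof -
  have Inl: "Inl \<in> sides" by (simp add: sides_def)
  let ?I = "surf_points - Inl ` curve"
  have sub: "Inl ` curve \<subseteq> surf_points" by (auto simp: surf_points_def)
  have n: "2 * (n - 1) + 2 = 2 * n" using n_ge_2 by simp
  have I: "finite ?I"
  proof (rule finite_subset)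
    \<comment> \<open>The affine part misses only the points u = 0 of the second copy, where the
      equation reads v^2 = -1.\<close>
    show "?I \<subseteq> Inr ` ({0} \<times> {v. v ^ 2 = -1})"
      using flip_curve[of _ \<i>] n_ge_2
      by (auto simp: surf_points_def at_inf_def split: if_splits) (auto simp: curve_def image_iff power_0_left)
    have "{v::complex. v ^ 2 = -1} \<subseteq> {\<i>, -\<i>}" using power2_eq_iff[of _ \<i>] by auto
    then show "finite (Inr ` ({0} \<times> {v::complex. v ^ 2 = -1}) :: point set)"
      by (intro finite_imageI finite_cartesian_product) (auto intro: finite_subset)
  qed
  have hol: "holomorphic_function surf (surf_points - ?I) (k \<circ> inv_into curve Inl)" if "k \<in> {fst, snd}" for k
  proof -
    have "surf_points - ?I = Inl ` curve" using sub by auto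
    then show ?thesis
      unfolding holomorphic_function_def
      using chart_transition_holomorphic[OF _ Inl _ order_refl that] by (auto elim!: atlas_cases)
  qed
  have "{(a, b). b ^ 2 = (\<Prod>j<2 * n. a - circ (real j))} = curve"
    by (simp add: roots_of_unity_prod curve_def)
  moreover have "surf_points - ?I = Inl ` curve" using sub by auto
  ultimately have "homeomorphic_map (subtopology surf_top (surf_points - ?I))
      (top_of_set {(a, b). b ^ 2 = (\<Prod>j<2 * n. a - circ (real j))})
      (\<lambda>p. ((fst \<circ> inv_into curve Inl) p, (snd \<circ> inv_into curve Inl) p))"
    using homeomorphic_affine_part by simp
  moreover have "inj_on (\<lambda>j. circ (real j)) {..<2 * n}"
    using bij_circ_roots by (simp add: bij_betw_def)
  ultimately show ?thesis
    unfolding hyperelliptic_def n rs_topology_surf topspace_surf using I hol by blast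
qed

end

section \<open>Exact forms and immersions\<close>

lemma open_chart_image:
  assumes "complex_chart T (U, h)" "openin T W" "W \<subseteq> U"
  shows "open (h ` W)"
proof -
  have U: "openin T U" "open (h ` U)" "homeomorphic_map (subtopology T U) (top_of_set (h ` U)) h"
    using assms(1) by (auto simp: complex_chart_def)
  have "openin (subtopology T U) W"
    using assms(2,3) U(1) by (simp add: openin_open_subtopology)
  then have "openin (top_of_set (h ` U)) (h ` W)"
    using homeomorphic_imp_open_map[OF U(3)] by (simp add: open_map_def)
  then show ?thesis using U(2) by (simp add: openin_open_eq)
qed

lemma complex_chart_inj:
  assumes "complex_chart T (U, h)"
  shows "inj_on h U"
proof -
  have "openin T U" "homeomorphic_map (subtopology T U) (top_of_set (h ` U)) h"
    using assms by (auto simp: complex_chart_def)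
  then show ?thesis
    using homeomorphic_imp_injective_map[of "subtopology T U" _ h] openin_subset[of T U]
    by (simp add: Int_absorb1)
qed

lemma closed_riemann_surfaceD:
  assumes "closed_riemann_surface S"
  shows "\<And>U h. (U, h) \<in> rs_atlas S \<Longrightarrow> complex_chart (rs_topology S) (U, h)"
    "\<And>U h V k. (U, h) \<in> rs_atlas S \<Longrightarrow> (V, k) \<in> rs_atlas S \<Longrightarrow>
       (k \<circ> inv_into U h) holomorphic_on h ` (U \<inter> V)"
    "\<And>P. finite P \<Longrightarrow> P \<subseteq> rs_points S \<Longrightarrow> closedin (rs_topology S) P"
  using assms unfolding closed_riemann_surface_def
  by (blast, blast, metis Hausdorff_imp_t1_space t1_space_closedin_finite)

lemma open_chart_minus_finite:
  assumes "closed_riemann_surface S" "(U, h) \<in> rs_atlas S" "finite P" "P \<subseteq> rs_points S"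
  shows "open (h ` (U - P))"
proof (rule open_chart_image[OF closed_riemann_surfaceD(1)[OF assms(1,2)]])
  show "openin (rs_topology S) (U - P)"
    using closed_riemann_surfaceD(1)[OF assms(1,2)] closed_riemann_surfaceD(3)[OF assms(1,3,4)]
    by (intro openin_diff) (auto simp: complex_chart_def)
qed auto

text \<open>The form is the differential dF of a global function, so the transformation law between
  charts is the chain rule.\<close>

lemma meromorphic_form_deriv:
  assumes S: "closed_riemann_surface S" and P: "finite P" "P \<subseteq> rs_points S"
    and mer: "\<And>U h. (U, h) \<in> rs_atlas S \<Longrightarrow> (F \<circ> inv_into U h) meromorphic_on h ` U"
    and hol: "\<And>U h. (U, h) \<in> rs_atlas S \<Longrightarrow> (F \<circ> inv_into U h) holomorphic_on h ` (U - P)"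
  shows "meromorphic_form S P (\<lambda>(U, h). deriv (F \<circ> inv_into U h))"
proof -
  have regular: "deriv (F \<circ> inv_into U h) meromorphic_on h ` U \<and>
     deriv (F \<circ> inv_into U h) holomorphic_on h ` (U - P)" if "(U, h) \<in> rs_atlas S" for U h
    using that mer hol open_chart_minus_finite[OF S _ P]
    by (auto intro!: meromorphic_on_deriv holomorphic_deriv)
  have change: "deriv (F \<circ> inv_into U h) (h p) =
      deriv (F \<circ> inv_into V k) (k p) * deriv (k \<circ> inv_into U h) (h p)"
    if Uh: "(U, h) \<in> rs_atlas S" and Vk: "(V, k) \<in> rs_atlas S"
      and p: "p \<in> U" "p \<in> V" "p \<notin> P" for U h V k p
  proof -
    note C = closed_riemann_surfaceD(1)[OF S Uh] closed_riemann_surfaceD(1)[OF S Vk]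
    let ?T = "k \<circ> inv_into U h"
    have inv: "inv_into U h (h q) = q" if "q \<in> U" for q
      using complex_chart_inj[OF C(1)] that by (rule inv_into_f_f)
    have invV: "inv_into V k (k q) = q" if "q \<in> V" for q
      using complex_chart_inj[OF C(2)] that by (rule inv_into_f_f)
    have op: "open (h ` (U \<inter> V))"
      using C by (intro open_chart_image[OF C(1)]) (auto simp: complex_chart_def)
    have hp: "h p \<in> h ` (U \<inter> V)" using p by auto
    have T: "?T field_differentiable at (h p)"
      using closed_riemann_surfaceD(2)[OF S Uh Vk] op hp by (rule holomorphic_on_imp_differentiable_at)
    have G: "(F \<circ> inv_into V k) field_differentiable at (?T (h p))"
      using hol[OF Vk] open_chart_minus_finite[OF S Vk P] p
      by (intro holomorphic_on_imp_differentiable_at) (auto simp: inv)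
    have "eventually (\<lambda>z. z \<in> h ` (U \<inter> V)) (nhds (h p))" using op hp by (rule eventually_nhds_in_open)
    then have "eventually (\<lambda>z. (F \<circ> inv_into U h) z = ((F \<circ> inv_into V k) \<circ> ?T) z) (nhds (h p))"
      by (rule eventually_mono) (auto simp: inv invV)
    then have "deriv (F \<circ> inv_into U h) (h p) = deriv ((F \<circ> inv_into V k) \<circ> ?T) (h p)"
      by (rule deriv_cong_ev) simp
    also have "\<dots> = deriv (F \<circ> inv_into V k) (?T (h p)) * deriv ?T (h p)"
      by (rule deriv_chain[OF T G])
    also have "?T (h p) = k p" using p by (simp add: inv)
    finally show ?thesis .
  qed
  show ?thesis unfolding meromorphic_form_def
    by (intro conjI; clarsimp simp: regular; rule change; assumption)
qed

text \<open>Exactness removes the period problem: the real parts of the functions F_j are themselves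
  the coordinates of the map.\<close>

lemma real_primitive_Re:
  fixes F :: "'n::finite \<Rightarrow> 'a \<Rightarrow> complex"
  assumes S: "closed_riemann_surface S" and P: "finite P" "P \<subseteq> rs_points S"
    and hol: "\<And>j U h. (U, h) \<in> rs_atlas S \<Longrightarrow> (F j \<circ> inv_into U h) holomorphic_on h ` (U - P)"
  shows "real_primitive S P (\<lambda>j (U, h). deriv (F j \<circ> inv_into U h)) (\<lambda>q. \<chi> j. Re (F j q))"
proof -
  have main: "((\<lambda>q. \<chi> j. Re (F j q)) \<circ> inv_into U h has_derivative
      (\<lambda>v. \<chi> j. Re (deriv (F j \<circ> inv_into U h) (h p) * v))) (at (h p))"
    if Uh: "(U, h) \<in> rs_atlas S" and p: "p \<in> U" "p \<notin> P" for U h p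
  proof -
    have "((F j \<circ> inv_into U h) has_field_derivative deriv (F j \<circ> inv_into U h) (h p)) (at (h p))" for j
      using hol[OF Uh] open_chart_minus_finite[OF S Uh P] p by (intro holomorphic_derivI) auto
    then have "((\<lambda>z. Re ((F j \<circ> inv_into U h) z)) has_derivative
        (\<lambda>v. Re (deriv (F j \<circ> inv_into U h) (h p) * v))) (at (h p))" for j
      unfolding has_field_derivative_def by (rule bounded_linear.has_derivative[OF bounded_linear_Re])
    then show ?thesis
      by (subst has_derivative_componentwise_within) (auto simp: Basis_vec_def inner_axis o_def)
  qed
  show ?thesis unfolding real_primitive_def prod.case
    by (intro ballI case_prodI2, hypsubst, elim DiffE, rule main; assumption)
qed

section \<open>Critical points of the candidate map\<close>

lemma has_field_derivative_prod_linear_at_0: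
  fixes a b :: "'i \<Rightarrow> complex"
  assumes "finite A" "\<And>j. j \<in> A \<Longrightarrow> a j \<noteq> 0"
  shows "((\<lambda>x. \<Prod>j\<in>A. a j + b j * x) has_field_derivative (\<Sum>j\<in>A. b j / a j) * (\<Prod>j\<in>A. a j)) (at 0)"
  using assms
proof (induction A rule: finite_induct)
  case (insert i A)
  have "((\<lambda>x. (a i + b i * x) * (\<Prod>j\<in>A. a j + b j * x)) has_field_derivative
      b i * (\<Prod>j\<in>A. a j) + a i * ((\<Sum>j\<in>A. b j / a j) * (\<Prod>j\<in>A. a j))) (at 0)"
    using insert by (auto intro!: derivative_eq_intros)
  then show ?case using insert by (simp add: algebra_simps)
qed auto

text \<open>Here x' and y' stand for derivatives in a chart and R' for the derivative of R at x.
  Hypothesis \<open>1\<close> says that y/R is critical, and \<open>2\<close> is what criticality of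
  x^m y/R then leaves over. If y = 0, the differentiated equation forces x = 0, against x^N = 1. If
  y \<noteq> 0, it follows that x = 0 and y' = 0, whence R' = 0.\<close>

lemma weierstrass_algebra:
  fixes x y x' y' R R' :: complex and N m :: nat
  assumes curve: "y\<^sup>2 = x ^ N - 1" "2 * y * y' = of_nat N * x ^ (N - 1) * x'" "N \<ge> 2"
    and par: "x' = 1 \<or> y' = 1" and R: "R \<noteq> 0" "x = 0 \<Longrightarrow> R' \<noteq> 0" and m: "m \<ge> 1"
    and 1: "y' * R = y * R' * x'" and 2: "of_nat m * x ^ (m - 1) * x' * (y / R) = 0"
  shows False
proof (cases "y = 0")
  case True
  then have "y' = 0" using 1 R by simp
  then have "x' = 1" using par by simp
  then have "x = 0" using curve(2,3) True by simp
  then show False using curve(1,3) True by (simp add: power_0_left)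
next
  case False
  then have "x ^ (m - 1) * x' = 0" using 2 R m by simp
  moreover have "x' \<noteq> 0" using 1 R par by auto
  ultimately have x: "x = 0" by simp
  then have "y' = 0" using curve(2,3) False by (simp add: power_0_left)
  then have "R' = 0" using 1 False \<open>x' \<noteq> 0\<close> by simp
  then show False using R x by simp
qed

context hyperelliptic_gluing
begin

lemma inv_chart_curve:
  assumes "(W, k) \<in> coord_charts" "z \<in> k ` W"
  shows "inv_into W k z \<in> curve" "inv_into W k z \<in> W" "k (inv_into W k z) = z"
    "(snd (inv_into W k z))\<^sup>2 = fst (inv_into W k z) ^ (2 * n) - 1"
proof -
  note C = coord_chartD[OF assms(1)]
  show W: "inv_into W k z \<in> W" using assms(2) by (rule inv_into_into)
  then show c: "inv_into W k z \<in> curve" using C(7) by blast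
  show "k (inv_into W k z) = z" using assms(2) by (rule f_inv_into_f)
  show "(snd (inv_into W k z))\<^sup>2 = fst (inv_into W k z) ^ (2 * n) - 1"
    using c unfolding curve_def by (metis (mono_tags, lifting) case_prodD mem_Collect_eq prod.collapse)
qed

text \<open>With \<open>0\<close> and \<open>d - n\<close> for \<open>m\<close>, these are \<open>f\<^sub>2\<close> and \<open>f\<^sub>1\<close>; on the copy of the curve around infinity,
  the roles of \<open>f\<^sub>1\<close> and \<open>f\<^sub>2\<close> are exchanged.\<close>

definition coeff_fun :: "(complex \<Rightarrow> complex) \<Rightarrow> nat \<Rightarrow> complex \<times> complex \<Rightarrow> complex" where
  "coeff_fun R m w = fst w ^ m * (snd w / R (fst w))"

lemma coeff_fun_meromorphic:
  assumes "(W, k) \<in> coord_charts" "R holomorphic_on UNIV"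
  shows "(\<lambda>z. coeff_fun R m (inv_into W k z)) meromorphic_on k ` W"
proof -
  note C = coord_chartD[OF assms(1)]
  have "(R \<circ> (\<lambda>z. fst (inv_into W k z))) holomorphic_on k ` W"
    by (rule holomorphic_on_compose_gen[OF C(5) assms(2)]) auto
  then have "(\<lambda>z. R (fst (inv_into W k z))) meromorphic_on k ` W"
    using C(4) by (intro analytic_on_imp_meromorphic_on) (simp add: analytic_on_open o_def)
  moreover have "(\<lambda>z. fst (inv_into W k z)) meromorphic_on k ` W"
    "(\<lambda>z. snd (inv_into W k z)) meromorphic_on k ` W"
    using C(4-6) by (auto intro!: analytic_on_imp_meromorphic_on simp: analytic_on_open)
  ultimately show ?thesis unfolding coeff_fun_def by (intro meromorphic_intros)
qed

lemma coeff_fun_holomorphic: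
  assumes "(W, k) \<in> coord_charts" "R holomorphic_on UNIV" "A \<subseteq> k ` W"
    "\<And>z. z \<in> A \<Longrightarrow> R (fst (inv_into W k z)) \<noteq> 0"
  shows "(\<lambda>z. coeff_fun R m (inv_into W k z)) holomorphic_on A"
proof -
  note C = holomorphic_on_subset[OF coord_chartD(5)[OF assms(1)] assms(3)]
    holomorphic_on_subset[OF coord_chartD(6)[OF assms(1)] assms(3)]
  have "(R \<circ> (\<lambda>z. fst (inv_into W k z))) holomorphic_on A"
    by (rule holomorphic_on_compose_gen[OF C(1) assms(2)]) auto
  then show ?thesis
    using C assms(4) unfolding coeff_fun_def by (auto intro!: holomorphic_intros simp: o_def)
qed

lemma coeff_fun_immersion:
  assumes W: "(W, k) \<in> coord_charts" and R: "R holomorphic_on UNIV" "deriv R 0 \<noteq> 0"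
    and z: "z \<in> k ` W" "R (fst (inv_into W k z)) \<noteq> 0" and m: "m \<ge> 1"
  shows "deriv (\<lambda>z. coeff_fun R 0 (inv_into W k z)) z \<noteq> 0 \<or>
    deriv (\<lambda>z. coeff_fun R m (inv_into W k z)) z \<noteq> 0"
proof (rule ccontr)
  assume neg: "\<not> ?thesis"
  note C = coord_chartD[OF W]
  define \<xi> \<eta> where "\<xi> = (\<lambda>z. fst (inv_into W k z))" and "\<eta> = (\<lambda>z. snd (inv_into W k z))"
  define x' y' where "x' = deriv \<xi> z" and "y' = deriv \<eta> z"
  define R' where "R' = deriv R (\<xi> z)"
  have hol: "\<xi> holomorphic_on k ` W" "\<eta> holomorphic_on k ` W"
    using C(5,6) by (simp_all add: \<xi>_def \<eta>_def)
  have der: "(\<xi> has_field_derivative x') (at z)" "(\<eta> has_field_derivative y') (at z)"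
    unfolding x'_def y'_def using hol C(4) z(1) by (auto intro: holomorphic_derivI)
  have derR: "(R has_field_derivative R') (at (\<xi> z))"
    unfolding R'_def using R(1) by (intro holomorphic_derivI) auto
  have derRx: "((\<lambda>z. R (\<xi> z)) has_field_derivative R' * x') (at z)"
    using DERIV_chain2[OF derR der(1)] by simp
  have Rz: "R (\<xi> z) \<noteq> 0" using z(2) by (simp add: \<xi>_def)
  have c0: "\<eta> w ^ 2 = \<xi> w ^ (2 * n) - 1" if "w \<in> k ` W" for w
    using inv_chart_curve(4)[OF W that] by (simp add: \<xi>_def \<eta>_def)
  have "((\<lambda>w. \<eta> w ^ 2) has_field_derivative 2 * \<eta> z * y') (at z)"
    using der by (auto intro!: derivative_eq_intros)
  \<comment> \<open>A second expression for the derivative of y^2, from the curve equation;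
    comparing the two differentiates that equation.\<close>
  moreover have "((\<lambda>w. \<eta> w ^ 2) has_field_derivative of_nat (2 * n) * \<xi> z ^ (2 * n - 1) * x') (at z)"
  proof (rule has_field_derivative_transform_within_open)
    show "((\<lambda>w. \<xi> w ^ (2 * n) - 1) has_field_derivative of_nat (2 * n) * \<xi> z ^ (2 * n - 1) * x') (at z)"
      using der by (auto intro!: derivative_eq_intros)
  qed (use c0 C(4) z(1) in auto)
  ultimately have eq: "2 * \<eta> z * y' = of_nat (2 * n) * \<xi> z ^ (2 * n - 1) * x'"
    by (rule DERIV_unique)
  \<comment> \<open>The chart coordinate is x or y itself, and the identity has derivative
    1.\<close>
  have par: "x' = 1 \<or> y' = 1"
  proof -
    have kz: "k (inv_into W k w) = w" if "w \<in> k ` W" for w using inv_chart_curve(3)[OF W that] .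
    have id: "f' = 1" if "(f has_field_derivative f') (at z)" "\<And>w. w \<in> k ` W \<Longrightarrow> w = f w" for f f'
      using has_field_derivative_transform_within_open[OF DERIV_ident C(4) z(1), of f] that
        DERIV_unique by blast
    show ?thesis using C(2) kz id[OF der(1)] id[OF der(2)] by (auto simp: \<xi>_def \<eta>_def)
  qed
  have a': "((\<lambda>w. \<eta> w / R (\<xi> w)) has_field_derivative (y' * R (\<xi> z) - \<eta> z * (R' * x')) / (R (\<xi> z) * R (\<xi> z))) (at z)"
    by (rule DERIV_divide[OF der(2) derRx Rz])
  moreover have "(\<lambda>z. coeff_fun R 0 (inv_into W k z)) = (\<lambda>w. \<eta> w / R (\<xi> w))"
    by (simp add: coeff_fun_def \<xi>_def \<eta>_def)
  ultimately have a0: "(y' * R (\<xi> z) - \<eta> z * (R' * x')) / (R (\<xi> z) * R (\<xi> z)) = 0"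
    using neg DERIV_imp_deriv by metis
  \<comment> \<open>By \<open>a0\<close> the term x^m (y/R)' of the product rule drops out.\<close>
  have "((\<lambda>w. \<xi> w ^ m * (\<eta> w / R (\<xi> w))) has_field_derivative
      of_nat m * \<xi> z ^ (m - 1) * x' * (\<eta> z / R (\<xi> z))) (at z)"
    using DERIV_mult[OF DERIV_power[OF der(1), of m] a'[unfolded a0]] by (simp add: mult_ac)
  moreover have "(\<lambda>z. coeff_fun R m (inv_into W k z)) = (\<lambda>w. \<xi> w ^ m * (\<eta> w / R (\<xi> w)))"
    by (simp add: coeff_fun_def \<xi>_def \<eta>_def)
  ultimately have b0: "of_nat m * \<xi> z ^ (m - 1) * x' * (\<eta> z / R (\<xi> z)) = 0"
    using neg DERIV_imp_deriv by metis
  have "y' * R (\<xi> z) = \<eta> z * R' * x'" using a0 Rz by (simp add: field_simps)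
  moreover have "\<xi> z = 0 \<Longrightarrow> R' \<noteq> 0" using R(2) by (simp add: R'_def)
  moreover have "2 \<le> 2 * n" using n_ge_2 by simp
  ultimately show False using weierstrass_algebra[OF c0[OF z(1)] eq _ par Rz _ m _ b0] by blast
qed

end

section \<open>The Weierstrass data\<close>

definition real4 :: "complex \<Rightarrow> complex \<Rightarrow> real ^ 4" where
  "real4 a b = (\<chi> j. if j = 1 then Re a else if j = 2 then Im a else if j = 3 then Re b else Im b)"

lemma real4_nth [simp]:
  "real4 a b $ 1 = Re a" "real4 a b $ 2 = Im a" "real4 a b $ 3 = Re b" "real4 a b $ 4 = Im b"
  by (simp_all add: real4_def)

lemma real4_eq_iff: "real4 a b = real4 a' b' \<longleftrightarrow> a = a' \<and> b = b'"
  by (auto simp: vec_eq_iff forall_4 complex_eq_iff)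

lemma real4_diff: "real4 a b - real4 a' b' = real4 (a - a') (b - b')"
  and real4_add: "real4 a b + real4 a' b' = real4 (a + a') (b + b')"
  and real4_uminus: "- real4 a b = real4 (- a) (- b)"
  and real4_scaleR: "r *\<^sub>R real4 a b = real4 (r *\<^sub>R a) (r *\<^sub>R b)"
  by (simp_all add: vec_eq_iff forall_4)

lemma norm_real4: "(norm (real4 a b))\<^sup>2 = (cmod a)\<^sup>2 + (cmod b)\<^sup>2"
  unfolding power2_norm_eq_inner[of "real4 a b"] inner_vec_def sum_4 cmod_power2 by (simp add: power2_eq_square)

lemma continuous_on_real4 [continuous_intros]:
  assumes "continuous_on A f" "continuous_on A g"
  shows "continuous_on A (\<lambda>x. real4 (f x) (g x))"
proof (rule continuous_on_vec_lambda[of A "\<lambda>j x. real4 (f x) (g x) $ j", simplified])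
  fix j :: 4
  show "continuous_on A (\<lambda>x. real4 (f x) (g x) $ j)"
    using exhaust_4[of j] by (elim disjE) (auto intro!: continuous_intros assms)
qed

text \<open>With g = n - 1 the bounds are those of the theorem. The lower one makes the exponent d -
  n positive, so that f1 and f2 do not coincide; the upper one keeps \<omega>^d different from
  1.\<close>

locale symmetric_example = hyperelliptic_gluing +
  fixes d :: nat
  assumes d_bounds: "n + 1 \<le> d" "d < 2 * n"
begin

text \<open>On the second copy the product is the reversed polynomial u^d R(1/u), and the factor -i
  absorbs the i that \<open>flip\<close> attaches to y.\<close>

definition den :: "(complex \<times> complex \<Rightarrow> point) \<Rightarrow> complex \<Rightarrow> complex" where
  "den e x = (if e = Inl then \<Prod>j<d. x - circ (real j) else - \<i> * (\<Prod>j<d. 1 - circ (real j) * x))"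

text \<open>The complementary factor of x^(2n) - 1. On the curve y / \<open>den\<close> equals
  \<open>num\<close> / y, which makes the simple poles visible in the coordinate y.\<close>

definition num :: "(complex \<times> complex \<Rightarrow> point) \<Rightarrow> complex \<Rightarrow> complex" where
  "num e x = (if e = Inl then \<Prod>j=d..<2*n. x - circ (real j)
     else - \<i> * (\<Prod>j=d..<2*n. 1 - circ (real j) * x))"

definition ends :: "point set" where
  "ends = (\<lambda>j. Inl (circ (real j), 0)) ` {..<d}"

text \<open>At a point (0, v) at infinity the continuation has the value i v because the denominator
  of the second copy is -i at u = 0; f2 has a zero of order d - n there, whence its value 0.\<close>

definition f1 :: "point \<Rightarrow> complex" where
  "f1 q = (case q of Inl w \<Rightarrow> coeff_fun (den Inl) (d - n) w | Inr w \<Rightarrow> \<i> * snd w)"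

definition f2 :: "point \<Rightarrow> complex" where
  "f2 q = (case q of Inl w \<Rightarrow> coeff_fun (den Inl) 0 w | Inr w \<Rightarrow> 0)"

lemma circ_nonzero [simp]: "circ \<tau> \<noteq> 0"
  using norm_circ[of \<tau>] by (metis norm_zero zero_neq_one)

lemma prod_reverse: "u \<noteq> 0 \<Longrightarrow> (\<Prod>j\<in>A. 1 / u - c j) * u ^ card A = (\<Prod>j\<in>A. 1 - c j * u)" for u :: complex
proof -
  assume "u \<noteq> 0"
  have "(\<Prod>j\<in>A. 1 / u - c j) * u ^ card A = (\<Prod>j\<in>A. (1 / u - c j) * u)" by (simp add: prod.distrib)
  also have "\<dots> = (\<Prod>j\<in>A. 1 - c j * u)" using \<open>u \<noteq> 0\<close> by (simp add: left_diff_distrib)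
  finally show ?thesis .
qed

lemma den_num:
  assumes "e \<in> sides"
  shows "den e x * num e x = x ^ (2 * n) - 1"
proof -
  have set: "{..<2 * n} = {..<d} \<union> {d..<2 * n}" "{..<d} \<inter> {d..<2 * n} = {}" using d_bounds by auto
  have prod: "(\<Prod>j<2 * n. g j) = (\<Prod>j<d. g j) * (\<Prod>j=d..<2*n. g j)" for g :: "nat \<Rightarrow> complex"
    unfolding set(1) by (rule prod.union_disjoint) (auto simp: set(2))
  show ?thesis
  proof (cases "e = Inl")
    case True
    then show ?thesis by (simp add: den_def num_def prod[symmetric] roots_of_unity_prod)
  next
    case False
    \<comment> \<open>The two factors -i multiply to -1, which turns 1 - x^(2n) into x^(2n) -
      1.\<close>
    have i: "- \<i> * a * (- \<i> * b) = - (a * b)" for a b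
      by (simp add: complex_eq_iff algebra_simps)
    from False have "den e x * num e x = - (\<Prod>j<2 * n. 1 - circ (real j) * x)"
      unfolding prod i[symmetric] by (simp only: den_def num_def if_False)
    also have "\<dots> = x ^ (2 * n) - 1"
    proof (cases "x = 0")
      case True
      then show ?thesis using n_ge_2 by (simp add: power_0_left)
    next
      case False
      then show ?thesis
        using prod_reverse[OF False, of "\<lambda>j. circ (real j)" "{..<2 * n}", symmetric]
        by (simp add: roots_of_unity_prod left_diff_distrib power_one_over)
    qed
    finally show ?thesis .
  qed
qed

text \<open>Substituting x = 1/u and y = i v / u^n turns R(x) into p / u^d. Since d = (d - n) + n, a
  surplus power u^(d-n) remains in f2 and is cancelled in f1 by x^(d-n).\<close>

lemma f_at_inf:
  "f1 (at_inf w) = coeff_fun (den at_inf) 0 w" "f2 (at_inf w) = coeff_fun (den at_inf) (d - n) w"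
proof -
  obtain u v where w: "w = (u, v)" by (cases w)
  have "f1 (at_inf w) = coeff_fun (den at_inf) 0 w \<and> f2 (at_inf w) = coeff_fun (den at_inf) (d - n) w"
  proof (cases "u = 0")
    case True
    then show ?thesis using d_bounds
      by (simp add: w at_inf_def f1_def f2_def coeff_fun_def den_def Inl_neq_at_inf[symmetric] field_simps)
  next
    case False
    define p where "p = (\<Prod>j<d. 1 - circ (real j) * u)"
    have u: "u ^ d = u ^ (d - n) * u ^ n" using d_bounds by (simp flip: power_add)
    have "(\<Prod>j<d. 1 / u - circ (real j)) = p / u ^ d"
      using prod_reverse[OF False, of "\<lambda>j. circ (real j)" "{..<d}"] False by (simp add: p_def field_simps)
    then have den: "den Inl (1 / u) = p / u ^ d" "den at_inf u = - \<i> * p"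
      using Inl_neq_at_inf by (simp_all add: den_def p_def)
    have f: "f1 (at_inf w) = (1 / u) ^ (d - n) * (\<i> * v / u ^ n / (p / u ^ d))"
      "f2 (at_inf w) = \<i> * v / u ^ n / (p / u ^ d)"
      using False by (simp_all add: w at_inf_def f1_def f2_def coeff_fun_def flip_def den)
    have i: "\<i> * v / p = v / (- \<i> * p)" by (simp add: divide_inverse)
    have "f2 (at_inf w) = u ^ (d - n) * (\<i> * v / p)"
      unfolding f u using False by simp
    moreover have "f1 (at_inf w) = \<i> * v / p"
      unfolding f u using False by (simp add: power_divide)
    ultimately show ?thesis unfolding i by (simp add: coeff_fun_def den w)
  qed
  then show "f1 (at_inf w) = coeff_fun (den at_inf) 0 w" "f2 (at_inf w) = coeff_fun (den at_inf) (d - n) w"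
    by auto
qed

lemma f_side:
  assumes "e \<in> sides"
  obtains "\<And>w. f1 (e w) = coeff_fun (den e) (d - n) w" "\<And>w. f2 (e w) = coeff_fun (den e) 0 w"
  | "\<And>w. f1 (e w) = coeff_fun (den e) 0 w" "\<And>w. f2 (e w) = coeff_fun (den e) (d - n) w"
  using assms f_at_inf unfolding sides_def by (auto simp: f1_def f2_def)

lemma f_side_coeff_fun:
  assumes "e \<in> sides" "F \<in> {f1, f2}"
  shows "\<exists>l. \<forall>w. F (e w) = coeff_fun (den e) l w"
  using assms(1)
proof (cases rule: f_side)
  case 1
  then show ?thesis using assms(2) by auto
next
  case 2
  then show ?thesis using assms(2) by auto
qed

lemma den_holomorphic: "den e holomorphic_on A" and num_holomorphic: "num e holomorphic_on A"
  unfolding den_def num_def by (cases "e = Inl"; simp; intro holomorphic_intros)+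

lemma geometric_sum_nonzero:
  fixes c :: complex
  assumes "c ^ d \<noteq> 1"
  shows "(\<Sum>j<d. c ^ j) \<noteq> 0"
  using assms one_diff_power_eq[of c d] by auto

lemma circ_power_eq: "circ (real j) = circ 1 ^ j"
  by (simp add: circ_def Complex.DeMoivre mult_ac)

text \<open>Up to sign the logarithmic derivative at 0 is a geometric sum, of ratio 1/\<omega> in
  the first copy and \<omega> in the second. With d terms it can vanish only if \<omega>^d = 1,
  which 0 < d < 2n excludes.\<close>

lemma deriv_den_nonzero: "deriv (den e) 0 \<noteq> 0"
proof -
  have c: "circ 1 ^ d \<noteq> 1"
  proof
    assume "circ 1 ^ d = 1"
    then have "circ (real d) = circ 0" by (simp add: circ_power_eq[symmetric]) (simp add: circ_def)
    then have "real d = 0" using d_bounds by (intro circ_inj[of "real d" 0]) auto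
    then show False using d_bounds by simp
  qed
  show ?thesis
  proof (cases "e = Inl")
    case True
    let ?D = "(\<Sum>j<d. 1 / (- circ (real j))) * (\<Prod>j<d. - circ (real j))"
    have "((\<lambda>x. \<Prod>j<d. - circ (real j) + 1 * x) has_field_derivative ?D) (at 0)"
      by (rule has_field_derivative_prod_linear_at_0) auto
    moreover have "(\<lambda>x. \<Prod>j<d. - circ (real j) + 1 * x) = den e" using True by (auto simp: den_def)
    ultimately have "deriv (den e) 0 = ?D" using DERIV_imp_deriv by metis
    also have "(\<Sum>j<d. 1 / (- circ (real j))) = - (\<Sum>j<d. (1 / circ 1) ^ j)"
      unfolding circ_power_eq by (simp add: sum_negf power_one_over)
    finally show ?thesis using geometric_sum_nonzero[of "1 / circ 1"] c
      by (simp add: power_one_over)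
  next
    case False
    let ?D = "(\<Sum>j<d. (- circ (real j)) / 1) * (\<Prod>j<d. 1)"
    have "((\<lambda>x. \<Prod>j<d. 1 + (- circ (real j)) * x) has_field_derivative ?D) (at 0)"
      by (rule has_field_derivative_prod_linear_at_0) auto
    then have "((\<lambda>x. - \<i> * (\<Prod>j<d. 1 + (- circ (real j)) * x)) has_field_derivative - \<i> * ?D) (at 0)"
      by (rule DERIV_cmult)
    moreover have "(\<lambda>x. - \<i> * (\<Prod>j<d. 1 + (- circ (real j)) * x)) = den e" using False by (auto simp: den_def)
    ultimately have "deriv (den e) 0 = - \<i> * ?D" using DERIV_imp_deriv by metis
    also have "?D = - (\<Sum>j<d. circ 1 ^ j)" by (simp add: circ_power_eq sum_negf)
    finally show ?thesis using geometric_sum_nonzero[OF c] by simp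
  qed
qed

text \<open>A zero of the denominator is a root of unity, which forces y = 0. In the second copy the
  zeros are the inverses \<omega>^(-j), and the gluing sends them back to the points listed in
  \<open>ends\<close>.\<close>

lemma ends_iff:
  assumes "e \<in> sides" "w \<in> curve"
  shows "e w \<in> ends \<longleftrightarrow> den e (fst w) = 0"
proof -
  obtain x y where w: "w = (x, y)" by (cases w)
  have y: "y = 0" if "x ^ (2 * n) = 1" using assms(2) that by (simp add: w curve_def)
  show ?thesis
  proof (cases "e = Inl")
    case True
    then have "den e x = 0 \<longleftrightarrow> (\<exists>j<d. x = circ (real j))" by (auto simp: den_def)
    then show ?thesis using True y circ_nat_power by (auto simp: ends_def w)
  next
    case False
    then have e: "e = at_inf" using assms(1) by (auto simp: sides_def)
    have "den e x = 0 \<longleftrightarrow> (\<exists>j<d. circ (real j) * x = 1)" using False by (auto simp: den_def)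
    also have "\<dots> \<longleftrightarrow> x \<noteq> 0 \<and> (\<exists>j<d. 1 / x = circ (real j))"
    proof -
      have "circ (real j) * x = 1 \<longleftrightarrow> x \<noteq> 0 \<and> 1 / x = circ (real j)" for j
        by (cases "x = 0") (auto simp: divide_eq_eq)
      then show ?thesis by auto
    qed
    also have "\<dots> \<longleftrightarrow> e w \<in> ends"
    proof -
      have "y = 0" if "1 / x = circ (real j)" "x \<noteq> 0" for j
      proof (rule y)
        have "(1 / x) ^ (2 * n) = 1" unfolding that(1) by (rule circ_nat_power)
        then show "x ^ (2 * n) = 1" using that(2) by (simp add: field_simps)
      qed
      then show ?thesis by (auto simp: ends_def e at_inf_def w flip_def)
    qed
    finally show ?thesis by (simp add: w)
  qed
qed

lemma finite_ends: "finite ends" and card_ends: "card ends = d" and ends_subset: "ends \<subseteq> surf_points"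
proof -
  show "finite ends" by (simp add: ends_def)
  have "inj_on (\<lambda>j. circ (real j)) {..<2 * n}" using bij_circ_roots by (simp add: bij_betw_def)
  then have "inj_on (\<lambda>j. Inl (circ (real j), 0) :: point) {..<d}"
    using d_bounds by (auto simp: inj_on_def)
  then show "card ends = d" by (simp add: ends_def card_image)
  show "ends \<subseteq> surf_points"
    using circ_nat_power by (auto simp: ends_def surf_points_def curve_def)
qed

lemma chart_function:
  assumes "(U, h) \<in> rs_atlas surf" "F \<in> {f1, f2}"
  shows "(F \<circ> inv_into U h) meromorphic_on h ` U" "(F \<circ> inv_into U h) holomorphic_on h ` (U - ends)"
proof -
  obtain e W k where e: "e \<in> sides" "(W, k) \<in> coord_charts" "U = e ` W" "h = k \<circ> inv_into curve e"
    using atlas_cases[OF assms(1)] .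
  note C = coord_chartD[OF e(2)]
  have hU: "h ` U = k ` W" using chart_image[OF e(1) C(7)] by (simp add: e)
  obtain l where l: "\<forall>w. F (e w) = coeff_fun (den e) l w"
    using f_side_coeff_fun[OF e(1) assms(2)] by (rule exE)
  have eq: "(F \<circ> inv_into U h) z = coeff_fun (den e) l (inv_into W k z)" if "z \<in> k ` W" for z
    using inv_into_chart[OF e(1,2) that] by (simp add: e l)
  have "(\<lambda>z. coeff_fun (den e) l (inv_into W k z)) meromorphic_on k ` W"
    using e(2) den_holomorphic by (rule coeff_fun_meromorphic)
  then show "(F \<circ> inv_into U h) meromorphic_on h ` U" unfolding hU
  proof (rule meromorphic_on_cong[THEN iffD1, rotated 2])
    fix z assume "z \<in> k ` W"
    then have "eventually (\<lambda>w. w \<in> k ` W) (at z)" using C(4) by (rule eventually_at_in_open'[rotated])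
    then show "eventually (\<lambda>w. coeff_fun (den e) l (inv_into W k w) = (F \<circ> inv_into U h) w) (at z)"
      by (rule eventually_mono) (use eq in auto)
  qed auto
  have sub: "h ` (U - ends) \<subseteq> k ` W" using hU by blast
  have "(\<lambda>z. coeff_fun (den e) l (inv_into W k z)) holomorphic_on h ` (U - ends)"
  proof (rule coeff_fun_holomorphic[OF e(2) den_holomorphic sub])
    fix z assume "z \<in> h ` (U - ends)"
    then obtain q where q: "q \<in> U - ends" "z = h q" by blast
    then obtain w where w: "w \<in> W" "q = e w" using e(3) by blast
    have wc: "w \<in> curve" using w C(7) by blast
    have "z = k w" using q(2) w inv_side[OF e(1) wc] by (simp add: e(4))
    then have "inv_into W k z = w" using inv_into_f_f[OF C(3) w(1)] by simp
    then show "den e (fst (inv_into W k z)) \<noteq> 0" using ends_iff[OF e(1) wc] q(1) w(2) by simp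
  qed
  then show "(F \<circ> inv_into U h) holomorphic_on h ` (U - ends)"
    by (rule holomorphic_transform) (use eq sub in auto)
qed

lemma chart_immersion:
  assumes "(U, h) \<in> rs_atlas surf" "p \<in> U - ends"
  shows "deriv (f1 \<circ> inv_into U h) (h p) \<noteq> 0 \<or> deriv (f2 \<circ> inv_into U h) (h p) \<noteq> 0"
proof -
  obtain e W k where e: "e \<in> sides" "(W, k) \<in> coord_charts" "U = e ` W" "h = k \<circ> inv_into curve e"
    using atlas_cases[OF assms(1)] .
  note C = coord_chartD[OF e(2)]
  obtain w where w: "w \<in> W" "p = e w" using e(3) assms(2) by blast
  have wc: "w \<in> curve" using w C(7) by blast
  have z: "h p = k w" using w inv_side[OF e(1) wc] by (simp add: e(4))
  have kw: "k w \<in> k ` W" using w by blast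
  have nz: "den e (fst (inv_into W k (k w))) \<noteq> 0"
    using ends_iff[OF e(1) wc] assms(2) w(2) inv_into_f_f[OF C(3) w(1)] by simp
  have m: "d - n \<ge> 1" using d_bounds by simp
  have eq: "deriv (F \<circ> inv_into U h) (h p) = deriv (\<lambda>z. F (e (inv_into W k z))) (k w)" for F
    unfolding z
  proof (rule deriv_cong_ev)
    have "eventually (\<lambda>z. z \<in> k ` W) (nhds (k w))" using C(4) kw by (rule eventually_nhds_in_open)
    then show "eventually (\<lambda>z. (F \<circ> inv_into U h) z = F (e (inv_into W k z))) (nhds (k w))"
      by (rule eventually_mono) (simp add: inv_into_chart[OF e(1,2)] e(3,4))
  qed simp
  note imm = coeff_fun_immersion[OF e(2) den_holomorphic deriv_den_nonzero kw nz m]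
  show ?thesis unfolding eq
    by (rule f_side[OF e(1)]) (use imm in \<open>simp_all only: disj_commute\<close>)
qed

text \<open>Since Re (-i f) = Im f, the four real coordinates of (f1, f2) are real parts of
  meromorphic functions. The squares of df and -i df cancel, which is the conformality
  relation.\<close>

definition comp :: "4 \<Rightarrow> point \<Rightarrow> complex" where
  "comp j = (if j = 1 then f1 else if j = 2 then (\<lambda>q. - \<i> * f1 q)
     else if j = 3 then f2 else (\<lambda>q. - \<i> * f2 q))"

definition form :: "4 \<Rightarrow> point chart \<Rightarrow> complex \<Rightarrow> complex" where
  "form j = (\<lambda>(U, h). deriv (comp j \<circ> inv_into U h))"

definition surf_map :: "point \<Rightarrow> real ^ 4" where
  "surf_map q = real4 (f1 q) (f2 q)"

lemma surf_map_eq: "surf_map = (\<lambda>q. \<chi> j. Re (comp j q))"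
  by (auto simp: surf_map_def vec_eq_iff forall_4 comp_def)

lemma chart_comp:
  assumes "(U, h) \<in> rs_atlas surf"
  shows "(comp j \<circ> inv_into U h) meromorphic_on h ` U" "(comp j \<circ> inv_into U h) holomorphic_on h ` (U - ends)"
  using chart_function[OF assms] by (auto simp: comp_def o_def intro!: meromorphic_intros holomorphic_intros)

text \<open>Near an end y is a coordinate, and y^2 = \<open>den\<close> * \<open>num\<close>
  rewrites y / \<open>den\<close> as \<open>num\<close> / y. The numerator is nonzero at the end
  because its roots \<omega>^i have indices i from d on.\<close>

lemma surf_end_chart:
  assumes j: "j < d"
  obtains W where "(W, snd) \<in> coord_charts" "(circ (real j), 0) \<in> W"
    "\<And>y. y \<in> snd ` W \<Longrightarrow> y \<noteq> 0 \<Longrightarrow> f2 (Inl (inv_into W snd y)) = num Inl (fst (inv_into W snd y)) / y"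
    "num Inl (circ (real j)) \<noteq> 0"
proof -
  have "(circ (real j), 0) \<in> curve" using circ_nat_power by (simp add: curve_def)
  then obtain W where W: "(W, snd) \<in> coord_charts" "(circ (real j), 0) \<in> W" by (rule coord_chart_snd)
  have Inl: "Inl \<in> sides" by (simp add: sides_def)
  have "f2 (Inl (inv_into W snd y)) = num Inl (fst (inv_into W snd y)) / y" if y: "y \<in> snd ` W" "y \<noteq> 0" for y
  proof -
    let ?x = "fst (inv_into W snd y)"
    have "den Inl ?x * num Inl ?x = y\<^sup>2"
      using den_num[OF Inl] inv_chart_curve(3,4)[OF W(1) y(1)] by simp
    then have "y / den Inl ?x = num Inl ?x / y" using y(2)
      by (metis (no_types, lifting) frac_eq_eq mult.commute mult_eq_0_iff power2_eq_square power_eq_0_iff)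
    then show ?thesis using inv_chart_curve(3)[OF W(1) y(1)] by (simp add: f2_def coeff_fun_def)
  qed
  moreover have "num Inl (circ (real j)) \<noteq> 0"
  proof
    assume "num Inl (circ (real j)) = 0"
    then obtain i where i: "i \<in> {d..<2 * n}" "circ (real j) = circ (real i)" by (auto simp: num_def)
    have "real j = real i" by (rule circ_inj[OF i(2)]) (use i j d_bounds in auto)
    then show False using j i by simp
  qed
  ultimately show thesis using that W by blast
qed

text \<open>One component suffices: f2 has a pole at every end, and differentiation preserves
  poles.\<close>

lemma form_pole:
  assumes "p \<in> ends"
  shows "form_has_pole surf (form 3) p"
proof -
  obtain j where j: "j < d" "p = Inl (circ (real j), 0)" using assms by (auto simp: ends_def)
  have Inl: "Inl \<in> sides" by (simp add: sides_def)
  obtain W where W: "(W, snd) \<in> coord_charts" "(circ (real j), 0) \<in> W"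
    and f2: "\<And>y. y \<in> snd ` W \<Longrightarrow> y \<noteq> 0 \<Longrightarrow> f2 (Inl (inv_into W snd y)) = num Inl (fst (inv_into W snd y)) / y"
    and nz: "num Inl (circ (real j)) \<noteq> 0"
    using surf_end_chart[OF j(1)] by metis
  note C = coord_chartD[OF W(1)]
  define U :: "point set" and h :: "point \<Rightarrow> complex" where "U = Inl ` W" and "h = snd \<circ> inv_into curve Inl"
  have Uh: "(U, h) \<in> rs_atlas surf" using W(1) Inl by (auto simp: surf_def U_def h_def)
  have p: "p \<in> U" using W(2) j by (auto simp: U_def)
  have hp: "h p = 0" using inv_side[OF Inl, of "(circ (real j), 0)"] W(2) C(7) by (auto simp: h_def j(2))
  have 0: "0 \<in> snd ` W" using W(2) by force
  have inv0: "inv_into W snd 0 = (circ (real j), 0)" using inv_into_f_f[OF C(3) W(2)] by simp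
  let ?g = "\<lambda>y. num Inl (fst (inv_into W snd y))"
  have "(num Inl \<circ> (\<lambda>y. fst (inv_into W snd y))) holomorphic_on snd ` W"
    by (rule holomorphic_on_compose_gen[OF C(5) num_holomorphic]) auto
  then have "continuous_on (snd ` W) ?g" unfolding o_def by (rule holomorphic_on_imp_continuous_on)
  then have cont: "isCont ?g 0"
    using 0 continuous_on_eq_continuous_at[OF C(4)] by blast
  have pole: "is_pole (\<lambda>y. ?g y / y) 0"
  proof (rule is_pole_divide[OF cont])
    show "filterlim (\<lambda>y::complex. y) (at 0) (at 0)" by (rule filterlim_ident)
  qed (use nz inv0 in simp)
  have ev: "eventually (\<lambda>y. ?g y / y = (f2 \<circ> inv_into U h) y) (at 0)"
  proof -
    have "eventually (\<lambda>y. y \<in> snd ` W) (at (0::complex))" using 0 C(4) by (rule eventually_at_in_open'[rotated])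
    moreover have "eventually (\<lambda>y. y \<noteq> 0) (at (0::complex))" by (rule eventually_neq_at_within)
    ultimately show ?thesis
      by eventually_elim (use f2 inv_into_chart[OF Inl W(1)] in \<open>simp add: U_def h_def\<close>)
  qed
  have "is_pole (f2 \<circ> inv_into U h) 0" by (rule iffD1[OF is_pole_cong[OF ev refl] pole])
  moreover have "(f2 \<circ> inv_into U h) meromorphic_on {0}"
    using chart_function(1)[OF Uh, of f2] p hp by (auto intro: meromorphic_on_subset)
  ultimately have "is_pole (deriv (f2 \<circ> inv_into U h)) (h p)" by (simp add: is_pole_deriv_iff hp)
  then show ?thesis using Uh p unfolding form_has_pole_def by (auto simp: form_def comp_def intro!: bexI[of _ "(U, h)"])
qed

lemma complete_minimal_immersion_surf: "complete_minimal_immersion surf ends form surf_map"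
proof -
  note S = closed_riemann_surface_surf
  have P: "ends \<subseteq> rs_points surf" using ends_subset by simp
  have "meromorphic_form surf ends (form j)" for j
    unfolding form_def using chart_comp by (intro meromorphic_form_deriv[OF S finite_ends P])
  moreover have "\<exists>j. form_has_pole surf (form j) p" if "p \<in> ends" for p
    using form_pole[OF that] by blast
  moreover have "real_primitive surf ends form surf_map"
    unfolding form_def[abs_def] surf_map_eq using chart_comp(2)
    by (intro real_primitive_Re[OF S finite_ends P])
  moreover have "(\<Sum>j\<in>UNIV. (form j (U, h) (h p))\<^sup>2) = 0 \<and> (\<Sum>j\<in>UNIV. (cmod (form j (U, h) (h p)))\<^sup>2) > 0"
    if Uh: "(U, h) \<in> rs_atlas surf" and p: "p \<in> U - ends" for U h p
  proof -
    have diff: "(F \<circ> inv_into U h) field_differentiable at (h p)" if "F \<in> {f1, f2}" for F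
      using chart_function(2)[OF Uh that] open_chart_minus_finite[OF S Uh finite_ends P] p
      by (intro holomorphic_on_imp_differentiable_at) auto
    have "deriv (\<lambda>z. - \<i> * (F \<circ> inv_into U h) z) (h p) = - \<i> * deriv (F \<circ> inv_into U h) (h p)"
      if "F \<in> {f1, f2}" for F by (rule deriv_cmult[OF diff[OF that]])
    then have "form 2 (U, h) (h p) = - \<i> * deriv (f1 \<circ> inv_into U h) (h p)"
      "form 4 (U, h) (h p) = - \<i> * deriv (f2 \<circ> inv_into U h) (h p)"
      by (simp_all add: form_def comp_def o_def)
    moreover have "form 1 (U, h) (h p) = deriv (f1 \<circ> inv_into U h) (h p)"
      "form 3 (U, h) (h p) = deriv (f2 \<circ> inv_into U h) (h p)"
      by (simp_all add: form_def comp_def)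
    ultimately have sums: "(\<Sum>j\<in>UNIV. (form j (U, h) (h p))\<^sup>2) = 0"
      "(\<Sum>j\<in>UNIV. (cmod (form j (U, h) (h p)))\<^sup>2) =
        2 * (cmod (deriv (f1 \<circ> inv_into U h) (h p)))\<^sup>2 + 2 * (cmod (deriv (f2 \<circ> inv_into U h) (h p)))\<^sup>2"
      by (simp_all add: sum_4 power_mult_distrib norm_mult)
    have "(cmod (deriv (f1 \<circ> inv_into U h) (h p)))\<^sup>2 > 0 \<or> (cmod (deriv (f2 \<circ> inv_into U h) (h p)))\<^sup>2 > 0"
      using chart_immersion[OF Uh p] by (metis zero_less_norm_iff zero_less_power)
    then show ?thesis unfolding sums
      by (smt (verit) zero_le_power2)
  qed
  ultimately show ?thesis
    unfolding complete_minimal_immersion_def using S finite_ends P by (auto 4 3)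
qed

lemma symmetric_surf_map: "symmetric_about_origin (surf_map ` (surf_points - ends))"
proof -
  have "- surf_map q \<in> surf_map ` (surf_points - ends)" if q0: "q \<in> surf_points - ends" for q
  proof -
    obtain e w where q: "e \<in> sides" "w \<in> curve" "q = e w"
      using q0 by (metis Diff_iff surf_points_cases)
    let ?w = "(fst w, - snd w)"
    have w': "?w \<in> curve" using q(2) by (auto simp: curve_def)
    have odd: "coeff_fun R l ?w = - coeff_fun R l w" for R l by (simp add: coeff_fun_def)
    have "F (e ?w) = - F q" if "F \<in> {f1, f2}" for F
      using f_side_coeff_fun[OF q(1) that] odd unfolding q(3) by metis
    then have "surf_map (e ?w) = - surf_map q"
      by (simp add: surf_map_def real4_uminus)
    moreover have "e ?w \<in> surf_points - ends"
      using side_in_surf[OF q(1) w'] ends_iff[OF q(1) w'] ends_iff[OF q(1,2)] q0 q(3) by simp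
    ultimately show ?thesis by (metis image_eqI)
  qed
  then have sub: "uminus ` surf_map ` (surf_points - ends) \<subseteq> surf_map ` (surf_points - ends)" by auto
  \<comment> \<open>Negation is an involution, so applying it to one inclusion gives the reverse
    one.\<close>
  then have "uminus ` uminus ` surf_map ` (surf_points - ends) \<subseteq> uminus ` surf_map ` (surf_points - ends)"
    by (rule image_mono)
  then have "surf_map ` (surf_points - ends) \<subseteq> uminus ` surf_map ` (surf_points - ends)"
    by (simp add: image_image)
  with sub show ?thesis unfolding symmetric_about_origin_def by (rule equalityI)
qed

end

section \<open>Planar ends and embeddedness\<close>

lemma parallelogram_midpoint:
  fixes a b w :: complex
  shows "(cmod (a - w))\<^sup>2 + (cmod (b - w))\<^sup>2 = 2 * (cmod (w - (a + b) / 2))\<^sup>2 + (cmod (a - b))\<^sup>2 / 2"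
  unfolding cmod_power2 by (simp add: power2_eq_square field_simps)

definition complex_line :: "complex \<Rightarrow> (real ^ 4) set" where
  "complex_line c = range (\<lambda>w. real4 (c * w) w)"

lemma linear_complex_line: "linear (\<lambda>w. real4 (c * w) w)"
  by (rule linearI) (simp_all add: real4_add real4_scaleR algebra_simps)

lemma inj_complex_line: "inj (\<lambda>w. real4 (c * w) w)"
  by (rule injI) (simp add: real4_eq_iff)

lemma subspace_complex_line: "subspace (complex_line c)"
  unfolding complex_line_def by (rule linear_subspace_image[OF linear_complex_line subspace_UNIV])

lemma aff_dim_complex_line: "aff_dim (complex_line c) = 2"
proof -
  have "dim (complex_line c) = dim (UNIV :: complex set)"
    unfolding complex_line_def
    by (rule dim_image_eq[OF linear_complex_line]) (use inj_complex_line in simp)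
  then show ?thesis by (simp add: aff_dim_subspace[OF subspace_complex_line])
qed

text \<open>Multiplying the first coordinate by the conjugate of c is an isometry that turns the
  line into the diagonal. The nearest diagonal point is given by the midpoint of
  \<open>cnj c * a\<close> and b, as \<open>parallelogram_midpoint\<close> shows by completing the
  square; the height is |cnj c * a - b| / sqrt 2.\<close>

lemma
  assumes c: "cmod c = 1"
  shows closest_point_complex_line:
      "closest_point (complex_line c) (real4 a b) = real4 (c * ((cnj c * a + b) / 2)) ((cnj c * a + b) / 2)"
    and norm_height_complex_line:
      "norm (real4 a b - closest_point (complex_line c) (real4 a b)) \<le> cmod (cnj c * a - b)"
proof -
  define w0 where "w0 = (cnj c * a + b) / 2"
  have cc: "cnj c * c = 1" using complex_norm_square[of c] c by (simp add: mult.commute)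
  have dist: "(norm (real4 a b - real4 (c * w) w))\<^sup>2 =
      2 * (cmod (w - w0))\<^sup>2 + (cmod (cnj c * a - b))\<^sup>2 / 2" for w
  proof -
    have "cnj c * (a - c * w) = cnj c * a - w" using cc by (simp add: right_diff_distrib flip: mult.assoc)
    then have "cmod (a - c * w) = cmod (cnj c * a - w)" using c by (metis complex_mod_cnj mult_1 norm_mult)
    then have "(norm (real4 a b - real4 (c * w) w))\<^sup>2 = (cmod (cnj c * a - w))\<^sup>2 + (cmod (b - w))\<^sup>2"
      by (simp add: real4_diff norm_real4)
    then show ?thesis by (simp add: parallelogram_midpoint w0_def)
  qed
  have "real4 (c * w0) w0 = closest_point (complex_line c) (real4 a b)"
  proof (rule closest_point_unique)
    show "convex (complex_line c)" by (rule subspace_imp_convex[OF subspace_complex_line])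
    show "closed (complex_line c)" by (rule closed_subspace[OF subspace_complex_line])
    show "real4 (c * w0) w0 \<in> complex_line c" by (simp add: complex_line_def)
    show "\<forall>z\<in>complex_line c. dist (real4 a b) (real4 (c * w0) w0) \<le> dist (real4 a b) z"
    proof
      fix z assume "z \<in> complex_line c"
      then obtain w where z: "z = real4 (c * w) w" by (auto simp: complex_line_def)
      have "(dist (real4 a b) (real4 (c * w0) w0))\<^sup>2 \<le> (dist (real4 a b) z)\<^sup>2"
        unfolding z dist_norm dist by simp
      then show "dist (real4 a b) (real4 (c * w0) w0) \<le> dist (real4 a b) z"
        by (rule power2_le_imp_le) simp
    qed
  qed
  then show eq: "closest_point (complex_line c) (real4 a b) =
      real4 (c * ((cnj c * a + b) / 2)) ((cnj c * a + b) / 2)" by (simp add: w0_def)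
  have "(norm (real4 a b - closest_point (complex_line c) (real4 a b)))\<^sup>2 \<le> (cmod (cnj c * a - b))\<^sup>2"
    unfolding eq w0_def[symmetric] dist by simp
  then show "norm (real4 a b - closest_point (complex_line c) (real4 a b)) \<le> cmod (cnj c * a - b)"
    by (rule power2_le_imp_le) simp
qed

context symmetric_example
begin

text \<open>The quotient f1/f2 = x^m tends to c, which determines the plane. The projection has
  coordinate K(y)/y with K(0) \<noteq> 0, so its reciprocal y/K(y) is a local coordinate, and the
  end projects bijectively onto the outside of a disc.\<close>

lemma planar_end:
  assumes "p \<in> ends"
  shows "embedded_planar_end surf ends surf_map p"
proof -
  obtain j where j: "j < d" "p = Inl (circ (real j), 0)" using assms by (auto simp: ends_def)
  have Inl: "Inl \<in> sides" by (simp add: sides_def)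
  obtain W where W: "(W, snd) \<in> coord_charts" "(circ (real j), 0) \<in> W"
    and f2: "\<And>y. y \<in> snd ` W \<Longrightarrow> y \<noteq> 0 \<Longrightarrow> f2 (Inl (inv_into W snd y)) = num Inl (fst (inv_into W snd y)) / y"
    and nz: "num Inl (circ (real j)) \<noteq> 0"
    using surf_end_chart[OF j(1)] by metis
  note C = coord_chartD[OF W(1)]
  define D where "D = snd ` W"
  define \<gamma> where "\<gamma> = inv_into W snd"
  define \<xi> where "\<xi> = (\<lambda>y. fst (\<gamma> y))"
  define N where "N = (\<lambda>y. num Inl (\<xi> y))"
  define m where "m = d - n"
  define c where "c = circ (real j) ^ m"
  have c1: "cmod c = 1" by (simp add: c_def norm_power)
  have cc: "cnj c * c = 1" using complex_norm_square[of c] c1 by (simp add: mult.commute)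
  have opD: "open D" and D0: "0 \<in> D" using C(4) W(2) by (force simp: D_def)+
  have \<gamma>_snd: "\<gamma> (snd w) = w" "snd w \<in> D" if "w \<in> W" for w
    using that inv_into_f_f[OF C(3) that] by (auto simp: \<gamma>_def D_def)
  have \<gamma>W: "\<gamma> y \<in> W" "snd (\<gamma> y) = y" if "y \<in> D" for y
    using inv_chart_curve[OF W(1), of y] that by (auto simp: \<gamma>_def D_def)
  have \<gamma>0: "\<gamma> 0 = (circ (real j), 0)" using \<gamma>_snd[OF W(2)] by simp
  have hol\<xi>: "\<xi> holomorphic_on D" using C(5) by (simp add: \<xi>_def \<gamma>_def D_def)
  have "(num Inl \<circ> \<xi>) holomorphic_on D" by (rule holomorphic_on_compose_gen[OF hol\<xi> num_holomorphic]) auto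
  then have holN: "N holomorphic_on D" by (simp add: N_def o_def)
  have N0: "N 0 \<noteq> 0" using nz by (simp add: N_def \<xi>_def \<gamma>0)
  have f2': "f2 (Inl (\<gamma> y)) = N y / y" and f1': "f1 (Inl (\<gamma> y)) = \<xi> y ^ m * N y / y" if "y \<in> D" "y \<noteq> 0" for y
  proof -
    show 2: "f2 (Inl (\<gamma> y)) = N y / y" using f2[of y] that by (simp add: \<gamma>_def D_def N_def \<xi>_def)
    have "f1 (Inl (\<gamma> y)) = \<xi> y ^ m * f2 (Inl (\<gamma> y))"
      by (simp add: f1_def f2_def coeff_fun_def \<xi>_def m_def)
    then show "f1 (Inl (\<gamma> y)) = \<xi> y ^ m * N y / y" by (simp add: 2)
  qed
  \<comment> \<open>Inserting f2 = N/y and f1 = x^m N/y into the projection formula gives K/y as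
    projected coordinate and g N / y as bound for the height.\<close>
  define K where "K = (\<lambda>y. (cnj c * \<xi> y ^ m + 1) * N y / 2)"
  define g where "g = (\<lambda>y. cnj c * \<xi> y ^ m - 1)"
  have proj: "closest_point (complex_line c) (surf_map (Inl (\<gamma> y))) = real4 (c * (K y / y)) (K y / y)"
    and height: "norm (surf_map (Inl (\<gamma> y)) - closest_point (complex_line c) (surf_map (Inl (\<gamma> y)))) \<le>
      cmod (g y / y * N y)" if "y \<in> D" "y \<noteq> 0" for y
  proof -
    have "(cnj c * f1 (Inl (\<gamma> y)) + f2 (Inl (\<gamma> y))) / 2 = K y / y"
      using that(2) by (simp add: f1'[OF that] f2'[OF that] K_def field_simps)
    then show "closest_point (complex_line c) (surf_map (Inl (\<gamma> y))) = real4 (c * (K y / y)) (K y / y)"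
      unfolding surf_map_def closest_point_complex_line[OF c1] by simp
    have "cnj c * f1 (Inl (\<gamma> y)) - f2 (Inl (\<gamma> y)) = g y / y * N y"
      using that(2) by (simp add: f1'[OF that] f2'[OF that] g_def field_simps)
    then show "norm (surf_map (Inl (\<gamma> y)) - closest_point (complex_line c) (surf_map (Inl (\<gamma> y)))) \<le>
      cmod (g y / y * N y)"
      unfolding surf_map_def using norm_height_complex_line[OF c1] by metis
  qed
  text \<open>The \<open>x\<close>-coordinate is an even function of the local coordinate \<open>y\<close>, so the heights vanish in the limit.\<close>
  have der\<xi>: "(\<xi> has_field_derivative 0) (at 0)"
  proof -
    have der: "(\<xi> has_field_derivative deriv \<xi> 0) (at 0)" using hol\<xi> opD D0 by (rule holomorphic_derivI)
    \<comment> \<open>The equation x^(2n) = y^2 + 1 has no linear term in y, while x is nonzero at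
      the branch point; so x' must vanish.\<close>
    have "((\<lambda>y. \<xi> y ^ (2 * n)) has_field_derivative of_nat (2 * n) * \<xi> 0 ^ (2 * n - 1) * deriv \<xi> 0) (at 0)"
      using der by (auto intro!: derivative_eq_intros)
    moreover have "((\<lambda>y. \<xi> y ^ (2 * n)) has_field_derivative 0) (at 0)"
    proof (rule has_field_derivative_transform_within_open[OF _ opD D0])
      show "((\<lambda>y::complex. y\<^sup>2 + 1) has_field_derivative 0) (at 0)"
        by (auto intro!: derivative_eq_intros)
      show "y\<^sup>2 + 1 = \<xi> y ^ (2 * n)" if "y \<in> D" for y
        using inv_chart_curve(3,4)[OF W(1), of y] that by (simp add: D_def \<xi>_def \<gamma>_def)
    qed
    ultimately have "of_nat (2 * n) * \<xi> 0 ^ (2 * n - 1) * deriv \<xi> 0 = 0" by (rule DERIV_unique)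
    then have "deriv \<xi> 0 = 0" using n_ge_2 by (simp add: \<xi>_def \<gamma>0)
    then show ?thesis using der by simp
  qed
  have g0: "g 0 = 0" using cc by (simp add: g_def \<xi>_def \<gamma>0 c_def)
  have "(g has_field_derivative 0) (at 0)"
    unfolding g_def using der\<xi> by (auto intro!: derivative_eq_intros)
  \<comment> \<open>As g(0) = g'(0) = 0, the difference quotient g(y)/y absorbs the pole of the
    height bound.\<close>
  then have lim: "((\<lambda>y. g y / y) \<longlongrightarrow> 0) (at 0)" by (simp add: has_field_derivative_iff g0)
  have contN: "isCont N 0"
    using holN opD D0 holomorphic_on_imp_continuous_on continuous_on_eq_continuous_at by blast
  have lim: "((\<lambda>y. g y / y * N y) \<longlongrightarrow> 0) (at 0)"
    using tendsto_mult[OF lim contN[unfolded isCont_def]] by simp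
  have limit: "((\<lambda>q. surf_map q - closest_point (complex_line c) (surf_map q)) \<longlongrightarrow> 0) (atin surf_top p)"
    unfolding tendsto_iff
  proof (intro allI impI)
    fix \<epsilon> :: real assume "\<epsilon> > 0"
    then have "eventually (\<lambda>y. dist (g y / y * N y) 0 < \<epsilon>) (at 0)" using lim by (simp add: tendsto_iff)
    then obtain \<delta> where \<delta>: "\<delta> > 0" "\<And>y. y \<noteq> 0 \<Longrightarrow> cmod y < \<delta> \<Longrightarrow> cmod (g y / y * N y) < \<epsilon>"
      by (auto simp: eventually_at)
    let ?U = "Inl ` (W \<inter> {w. cmod (snd w) < \<delta>})"
    have "open {w::complex \<times> complex. cmod (snd w) < \<delta>}" by (intro open_Collect_less continuous_intros)
    then have "openin surf_top ?U" using C(1) by (intro open_side[OF Inl] openin_Int_open)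
    moreover have "p \<in> ?U" using W(2) \<delta>(1) by (auto simp: j(2))
    moreover have "dist (surf_map q - closest_point (complex_line c) (surf_map q)) 0 < \<epsilon>" if "q \<in> ?U - {p}" for q
    proof -
      obtain w where w: "w \<in> W" "cmod (snd w) < \<delta>" "q = Inl w" "q \<noteq> p" using \<open>q \<in> ?U - {p}\<close> by blast
      have "snd w \<noteq> 0" using \<gamma>_snd(1)[OF w(1)] \<gamma>0 w(3,4) j(2) by auto
      then show ?thesis
        using height[OF \<gamma>_snd(2)[OF w(1)]] \<delta>(2)[of "snd w"] w(2,3) \<gamma>_snd(1)[OF w(1)] by simp
    qed
    ultimately show "\<forall>\<^sub>F q in atin surf_top p. dist (surf_map q - closest_point (complex_line c) (surf_map q)) 0 < \<epsilon>"
      unfolding eventually_atin by blast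
  qed
  have holK: "K holomorphic_on D" unfolding K_def using hol\<xi> holN by (intro holomorphic_intros) auto
  have K0: "K 0 = N 0" using cc by (simp add: K_def \<xi>_def \<gamma>0 c_def)
  \<comment> \<open>The reciprocal of the projected coordinate. It extends holomorphically over the
    end with t(0) = 0 and derivative 1/K(0), hence is injective nearby.\<close>
  define t where "t = (\<lambda>y. y / K y)"
  define B0 where "B0 = D \<inter> K -` (- {0})"
  have opB0: "open B0" unfolding B0_def
    using holomorphic_on_imp_continuous_on[OF holK] opD by (intro continuous_open_preimage) auto
  have B00: "0 \<in> B0" using D0 K0 N0 by (simp add: B0_def)
  have holt: "t holomorphic_on B0" unfolding t_def
    using holomorphic_on_subset[OF holK, of B0] by (intro holomorphic_intros) (auto simp: B0_def)
  have "(t has_field_derivative 1 / K 0) (at 0)"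
    using DERIV_divide[OF DERIV_ident holomorphic_derivI[OF holK opD D0]] K0 N0 by (simp add: t_def)
  then have "deriv t 0 \<noteq> 0" using K0 N0 by (simp add: DERIV_imp_deriv)
  then obtain r where r: "r > 0" "ball 0 r \<subseteq> B0" "inj_on t (ball 0 r)"
    using has_complex_derivative_locally_injective[OF holt B00 opB0] by metis
  have t0: "t 0 = 0" by (simp add: t_def)
  have "open (t ` ball 0 r)"
    by (rule open_mapping_thm3[OF holomorphic_on_subset[OF holt r(2)] open_ball r(3)])
  moreover have "0 \<in> t ` ball 0 r" using t0 r(1) by (intro image_eqI[of _ _ 0]) auto
  ultimately obtain \<epsilon> where \<epsilon>: "\<epsilon> > 0" "ball 0 \<epsilon> \<subseteq> t ` ball 0 r" by (meson openE)
  \<comment> \<open>Trimming to the preimage of a round disc makes the projected end exactly the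
    complement of the closed disc of radius 1/\<epsilon>.\<close>
  define U0 where "U0 = ball 0 r \<inter> t -` ball 0 \<epsilon>"
  have opU0: "open U0" unfolding U0_def
    using holomorphic_on_imp_continuous_on[OF holomorphic_on_subset[OF holt r(2)]]
    by (intro continuous_open_preimage) auto
  have U0D: "y \<in> D" "K y \<noteq> 0" if "y \<in> U0" for y using that r(2) by (auto simp: U0_def B0_def)
  have U00: "0 \<in> U0" using r \<epsilon> t0 by (simp add: U0_def)
  define U :: "point set" where "U = Inl ` (W \<inter> snd -` U0)"
  have opU: "openin surf_top U" unfolding U_def
    using C(1) opU0 by (intro open_side[OF Inl] openin_Int_open open_vimage_snd)
  have Upt: "\<exists>y\<in>U0. q = Inl (\<gamma> y)" if "q \<in> U" for q
    using that \<gamma>_snd by (force simp: U_def)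
  have ptU: "Inl (\<gamma> y) \<in> U" if "y \<in> U0" for y
    using \<gamma>W[OF U0D(1)[OF that]] that by (auto simp: U_def)
  have pU: "p \<in> U" using ptU[OF U00] by (simp add: \<gamma>0 j(2))
  have UP: "U \<inter> ends = {p}"
  proof
    show "{p} \<subseteq> U \<inter> ends" using pU assms by simp
    show "U \<inter> ends \<subseteq> {p}"
    proof
      fix q assume q: "q \<in> U \<inter> ends"
      then obtain y where y: "y \<in> U0" "q = Inl (\<gamma> y)" using Upt by blast
      then have "snd (\<gamma> y) = 0" using q by (auto simp: ends_def)
      then have "y = 0" using \<gamma>W(2)[OF U0D(1)[OF y(1)]] by simp
      then show "q \<in> {p}" using y(2) by (simp add: \<gamma>0 j(2))
    qed
  qed
  let ?E = "\<lambda>w. real4 (c * w) w"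
  let ?C = "?E ` cball 0 (1 / \<epsilon>)"
  have "compact ?C" by (intro compact_continuous_image continuous_intros) auto
  have proj': "closest_point (complex_line c) (surf_map (Inl (\<gamma> y))) = ?E (1 / t y)"
    if "y \<in> U0" "y \<noteq> 0" for y using proj[OF U0D(1)[OF that(1)] that(2)] by (simp add: t_def)
  have bij: "bij_betw (\<lambda>q. closest_point (complex_line c) (surf_map q)) (U - {p}) (complex_line c - ?C)"
    unfolding bij_betw_def
  proof
    have nonzero: "y \<noteq> 0" if "Inl (\<gamma> y) \<in> U - {p}" for y using that by (auto simp: \<gamma>0 j(2))
    have t_nz: "t y \<noteq> 0" if "y \<in> U0" "y \<noteq> 0" for y using U0D[OF that(1)] that(2) by (simp add: t_def)
    show "inj_on (\<lambda>q. closest_point (complex_line c) (surf_map q)) (U - {p})"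
    proof (rule inj_onI)
      fix q q' assume q: "q \<in> U - {p}" "q' \<in> U - {p}"
        and eq: "closest_point (complex_line c) (surf_map q) = closest_point (complex_line c) (surf_map q')"
      obtain y where y: "y \<in> U0" "q = Inl (\<gamma> y)" using Upt q by blast
      obtain y' where y': "y' \<in> U0" "q' = Inl (\<gamma> y')" using Upt q by blast
      have y0: "y \<noteq> 0" "y' \<noteq> 0" using nonzero q y y' by auto
      have "1 / t y = 1 / t y'"
        using eq unfolding y(2) y'(2) proj'[OF y(1) y0(1)] proj'[OF y'(1) y0(2)] by (simp add: real4_eq_iff)
      then have "t y = t y'" by simp
      then have "y = y'" using r(3) y(1) y'(1) by (auto simp: U0_def dest: inj_onD)
      then show "q = q'" using y y' by simp
    qed
    show "(\<lambda>q. closest_point (complex_line c) (surf_map q)) ` (U - {p}) = complex_line c - ?C"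
    proof (intro equalityI subsetI)
      fix v assume "v \<in> (\<lambda>q. closest_point (complex_line c) (surf_map q)) ` (U - {p})"
      then obtain q where q: "q \<in> U - {p}" "v = closest_point (complex_line c) (surf_map q)" by blast
      obtain y where y: "y \<in> U0" "q = Inl (\<gamma> y)" using Upt q by blast
      have y0: "y \<noteq> 0" using nonzero q y by auto
      have v: "v = ?E (1 / t y)" using q(2) proj'[OF y(1) y0] y(2) by simp
      have "cmod (t y) < \<epsilon>" using y(1) by (simp add: U0_def)
      then have big: "\<not> cmod (1 / t y) \<le> 1 / \<epsilon>"
        using t_nz[OF y(1) y0] \<epsilon>(1) by (simp add: norm_divide divide_simps)
      have "?E (1 / t y) \<in> complex_line c" unfolding complex_line_def by (rule rangeI)
      moreover have "?E (1 / t y) \<notin> ?C" using big by (auto simp: real4_eq_iff)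
      ultimately show "v \<in> complex_line c - ?C" unfolding v by (rule DiffI)
    next
      fix v assume v: "v \<in> complex_line c - ?C"
      then obtain w where w: "v = ?E w" by (auto simp: complex_line_def)
      have big: "cmod w > 1 / \<epsilon>" 
      proof (rule ccontr)
        assume "\<not> cmod w > 1 / \<epsilon>"
        then have "w \<in> cball 0 (1 / \<epsilon>)" by simp
        then have "v \<in> ?C" unfolding w by (rule imageI)
        then show False using v by simp
      qed
      have "1 / \<epsilon> > 0" using \<epsilon>(1) by simp
      then have w0: "w \<noteq> 0" using big by auto
      have small: "cmod (1 / w) < \<epsilon>" using big w0 \<epsilon>(1) by (simp add: norm_divide field_simps)
      then have "1 / w \<in> t ` ball 0 r" using \<epsilon>(2) by (intro subsetD[OF \<epsilon>(2)]) simp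
      then obtain y where y: "y \<in> ball 0 r" "t y = 1 / w" by auto
      have yU: "y \<in> U0" using y small by (simp add: U0_def)
      have y0: "y \<noteq> 0" using y(2) w0 t0 by auto
      have "\<gamma> y \<noteq> \<gamma> 0" using \<gamma>W(2)[OF U0D(1)[OF yU]] \<gamma>W(2)[OF D0] y0 by metis
      then have "Inl (\<gamma> y) \<in> U - {p}" using ptU[OF yU] by (auto simp: j(2) \<gamma>0)
      moreover have "v = closest_point (complex_line c) (surf_map (Inl (\<gamma> y)))"
        unfolding proj'[OF yU y0] w y(2) using w0 by simp
      ultimately show "v \<in> (\<lambda>q. closest_point (complex_line c) (surf_map q)) ` (U - {p})" by blast
    qed
  qed
  show ?thesis
    unfolding embedded_planar_end_def rs_topology_surf
  proof (intro exI conjI)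
    show "openin surf_top U" by (rule opU)
    show "U \<inter> ends = {p}" by (rule UP)
    show "affine (complex_line c)" by (rule subspace_imp_affine[OF subspace_complex_line])
    show "aff_dim (complex_line c) = 2" by (rule aff_dim_complex_line)
    show "((\<lambda>q. surf_map q - closest_point (complex_line c) (surf_map q)) \<longlongrightarrow> 0) (atin surf_top p)"
      by (rule limit)
    \<comment> \<open>The neighbourhood \<open>U\<close> has already been trimmed, so nothing
      remains to be cut off by a compact set.\<close>
    show "compact ({} :: (real ^ 4) set)" by simp
    show "compact ?C" by fact
    show "bij_betw (\<lambda>q. closest_point (complex_line c) (surf_map q)) {q \<in> U - {p}. surf_map q \<notin> {}} (complex_line c - ?C)"
      using bij by (simp add: set_diff_eq)
  qed
qed

lemma symmetric_planar_example_surf: "symmetric_planar_example (n - 1) d surf ends form surf_map"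
  unfolding symmetric_planar_example_def
  using complete_minimal_immersion_surf has_genus_surf card_ends planar_end symmetric_surf_map hyperelliptic_surf
  by simp

section \<open>Properness and injectivity\<close>

lemma num_nonzero_if_den_zero:
  assumes "e \<in> sides" "den e x = 0"
  shows "num e x \<noteq> 0"
proof
  assume num: "num e x = 0"
  have x: "x ^ (2 * n) = 1" using den_num[OF assms(1), of x] num by simp
  \<comment> \<open>If both factors vanished at x, so would the derivative of x^(2n) - 1, whose
    roots are simple.\<close>
  have "((\<lambda>x. den e x * num e x) has_field_derivative deriv (den e) x * num e x + deriv (num e) x * den e x) (at x)"
    by (intro DERIV_mult holomorphic_derivI[OF den_holomorphic[of e UNIV]]
        holomorphic_derivI[OF num_holomorphic[of e UNIV]]) auto
  moreover have "(\<lambda>x. den e x * num e x) = (\<lambda>x. x ^ (2 * n) - 1)" using den_num[OF assms(1)] by auto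
  moreover have "((\<lambda>x. x ^ (2 * n) - 1) has_field_derivative of_nat (2 * n) * x ^ (2 * n - 1)) (at x)"
    by (auto intro!: derivative_eq_intros)
  ultimately have "of_nat (2 * n) * x ^ (2 * n - 1) = 0" using DERIV_unique num assms(2) by fastforce
  then have "x = 0" using n_ge_2 by simp
  then show False using x n_ge_2 by (simp add: power_0_left)
qed

text \<open>Since (y / \<open>den\<close>)^2 = \<open>num\<close> / \<open>den\<close> on the curve,
  the norm depends on x alone. In this form a bound on the norm can be cleared of its denominator
  and then makes sense at the ends as well.\<close>

lemma norm_surf_map:
  assumes "e \<in> sides" "w \<in> curve" "e w \<notin> ends"
  shows "(norm (surf_map (e w)))\<^sup>2 =
    cmod (num e (fst w)) * (1 + cmod (fst w) ^ (2 * (d - n))) / cmod (den e (fst w))"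
proof -
  have den: "den e (fst w) \<noteq> 0" using ends_iff[OF assms(1,2)] assms(3) by simp
  have "(snd w)\<^sup>2 = den e (fst w) * num e (fst w)"
    using assms(2) den_num[OF assms(1)] by (auto simp: curve_def)
  then have "(snd w / den e (fst w))\<^sup>2 = num e (fst w) / den e (fst w)"
    using den by (simp add: power_divide power2_eq_square)
  then have 0: "(cmod (snd w / den e (fst w)))\<^sup>2 = cmod (num e (fst w)) / cmod (den e (fst w))"
    by (metis norm_divide norm_power)
  have "(norm (surf_map (e w)))\<^sup>2 = (cmod (coeff_fun (den e) 0 w))\<^sup>2 + (cmod (coeff_fun (den e) (d - n) w))\<^sup>2"
    unfolding surf_map_def norm_real4 by (rule f_side[OF assms(1)]) (simp_all add: add.commute)
  also have "\<dots> = (1 + cmod (fst w) ^ (2 * (d - n))) * (cmod (snd w / den e (fst w)))\<^sup>2"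
  proof -
    have "(cmod (coeff_fun (den e) k w))\<^sup>2 = cmod (fst w) ^ (2 * k) * (cmod (snd w / den e (fst w)))\<^sup>2" for k
      unfolding coeff_fun_def norm_mult power_mult_distrib norm_power
      by (simp only: power_mult[symmetric] mult.commute)
    then show ?thesis by (simp add: algebra_simps)
  qed
  finally show ?thesis unfolding 0 by (simp add: mult_ac)
qed

lemma continuous_on_den_num:
  "continuous_on A (\<lambda>w :: complex \<times> complex. den e (fst w))"
  "continuous_on A (\<lambda>w :: complex \<times> complex. num e (fst w))"
  by (rule continuous_on_compose2[OF holomorphic_on_imp_continuous_on[OF den_holomorphic[of e UNIV]]]
      continuous_on_compose2[OF holomorphic_on_imp_continuous_on[OF num_holomorphic[of e UNIV]]];
      auto intro!: continuous_intros)+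

lemma open_non_ends: "openin surf_top (surf_points - ends)"
  using closed_riemann_surfaceD(3)[OF closed_riemann_surface_surf finite_ends] ends_subset
  by (metis openin_diff openin_topspace rs_topology_surf topspace_surf)

lemma continuous_surf_map:
  "continuous_map (subtopology surf_top (surf_points - ends)) euclidean surf_map"
proof -
  have "openin surf_top {q \<in> surf_points - ends. surf_map q \<in> V}" if V: "open V" for V
    unfolding openin_surf_top
  proof (intro conjI ballI)
    fix e assume e: "e \<in> sides"
    let ?A = "curve \<inter> {w. den e (fst w) \<noteq> 0}"
    have "continuous_on ?A (\<lambda>w. F (e w))" if "F \<in> {f1, f2}" for F
    proof -
      obtain l where "\<forall>w. F (e w) = coeff_fun (den e) l w" using f_side_coeff_fun[OF e \<open>F \<in> _\<close>] by (rule exE)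
      then have eq: "(\<lambda>w. F (e w)) = (\<lambda>w. fst w ^ l * (snd w / den e (fst w)))"
        by (simp add: fun_eq_iff coeff_fun_def)
      show ?thesis unfolding eq by (auto intro!: continuous_intros continuous_on_den_num)
    qed
    then have cont: "continuous_on ?A (\<lambda>w. surf_map (e w))"
      unfolding surf_map_def by (intro continuous_intros) auto
    have eq: "curve \<inter> e -` {q \<in> surf_points - ends. surf_map q \<in> V} = ?A \<inter> (\<lambda>w. surf_map (e w)) -` V"
    proof (intro set_eqI)
      fix w
      show "w \<in> curve \<inter> e -` {q \<in> surf_points - ends. surf_map q \<in> V} \<longleftrightarrow>
          w \<in> ?A \<inter> (\<lambda>w. surf_map (e w)) -` V"
        using ends_iff[OF e, of w] side_in_surf[OF e, of w] by (simp, blast)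
    qed
    have op1: "openin (top_of_set ?A) (?A \<inter> (\<lambda>w. surf_map (e w)) -` V)"
      using cont V by (rule continuous_openin_preimage_gen)
    have op2: "openin (top_of_set curve) ?A"
      by (intro openin_open_Int open_Collect_neq continuous_on_den_num continuous_intros)
    show "openin (top_of_set curve) (curve \<inter> e -` {q \<in> surf_points - ends. surf_map q \<in> V})"
      unfolding eq by (rule openin_trans[OF op1 op2])
  qed auto
  moreover have "topspace surf_top \<inter> (surf_points - ends) = surf_points - ends" by auto
  ultimately show ?thesis
    unfolding continuous_map using open_non_ends
    by (auto simp: openin_open_subtopology)
qed

text \<open>On each copy the complement is cut out by a strict inequality between continuous
  functions, with \<open>den\<close> multiplied out. The inequality holds at the ends too, where
  \<open>den\<close> is 0 and \<open>num\<close> is not, so the ends are interior points of the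
  complement.\<close>

lemma closed_sublevel: "closedin surf_top {q \<in> surf_points - ends. norm (surf_map q) \<le> r}"
proof (cases "r < 0")
  case True
  then have "{q \<in> surf_points - ends. norm (surf_map q) \<le> r} = {}"
    by (auto dest: order_trans[OF norm_ge_zero])
  then show ?thesis by (simp only: closedin_empty)
next
  case False
  let ?K = "{q \<in> surf_points - ends. norm (surf_map q) \<le> r}"
  have "openin surf_top (surf_points - ?K)"
    unfolding openin_surf_top
  proof (intro conjI ballI)
    fix e assume e: "e \<in> sides"
    let ?G = "{w :: complex \<times> complex. cmod (num e (fst w)) * (1 + cmod (fst w) ^ (2 * (d - n))) > r\<^sup>2 * cmod (den e (fst w))}"
    have iff: "e w \<in> surf_points - ?K \<longleftrightarrow> w \<in> ?G" if w: "w \<in> curve" for w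
    proof (cases "e w \<in> ends")
      case True
      then have den: "den e (fst w) = 0" using ends_iff[OF e w] by simp
      have "num e (fst w) \<noteq> 0"
        using den num_nonzero_if_den_zero[OF e] by simp
      moreover have "1 + cmod (fst w) ^ (2 * (d - n)) > 0" by (simp add: add_pos_nonneg)
      ultimately show ?thesis using True side_in_surf[OF e w] den by (simp add: mult_pos_pos)
    next
      case False
      then have den: "cmod (den e (fst w)) > 0" using ends_iff[OF e w] by simp
      have "e w \<in> surf_points - ?K \<longleftrightarrow> norm (surf_map (e w)) > r"
        using False side_in_surf[OF e w] by auto
      also have "\<dots> \<longleftrightarrow> (norm (surf_map (e w)))\<^sup>2 > r\<^sup>2"
        using \<open>\<not> r < 0\<close> by (metis abs_norm_cancel abs_of_nonneg linorder_not_less abs_le_square_iff)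
      also have "\<dots> \<longleftrightarrow> w \<in> ?G"
        unfolding norm_surf_map[OF e w False] using den by (simp add: pos_less_divide_eq)
      finally show ?thesis .
    qed
    have eq: "curve \<inter> e -` (surf_points - ?K) = curve \<inter> ?G"
      unfolding set_eq_iff Int_iff vimage_eq by (intro allI conj_cong refl iff)
    have "open ?G" by (intro open_Collect_less continuous_intros continuous_on_den_num)
    then show "openin (top_of_set curve) (curve \<inter> e -` (surf_points - ?K))"
      unfolding eq by (rule openin_open_Int)
  qed blast
  then show ?thesis by (auto simp: closedin_def)
qed

text \<open>Sublevel sets of the norm are closed in the compact surface, hence compact. Near a given
  target point only a compact part of \<open>Z\<close> matters, and its image is closed.\<close>

lemma closed_map_surf_map:
  "closed_map (subtopology surf_top (surf_points - ends)) euclidean surf_map"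
  unfolding closed_map_def
proof (intro allI impI)
  let ?S = "subtopology surf_top (surf_points - ends)"
  fix Z assume "closedin ?S Z"
  then obtain Z' where Z': "closedin surf_top Z'" "Z = Z' \<inter> (surf_points - ends)"
    by (auto simp: closedin_subtopology)
  have "v \<in> surf_map ` Z" if v: "v \<in> closure (surf_map ` Z)" for v
  proof -
    \<comment> \<open>The bound \<open>norm v + 1\<close> catches every point whose image lies in
      the unit ball around v.\<close>
    define K where "K = Z' \<inter> {q \<in> surf_points - ends. norm (surf_map q) \<le> norm v + 1}"
    have "closedin surf_top K" unfolding K_def by (intro closedin_Int Z'(1) closed_sublevel)
    then have "compactin surf_top K" using compact_surf closedin_compact_space by blast
    then have "compactin ?S K" by (auto simp: compactin_subtopology K_def)
    then have "compact (surf_map ` K)" using image_compactin[OF _ continuous_surf_map] by simp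
    then have cl: "closed (surf_map ` K)" by (rule compact_imp_closed)
    have "surf_map ` Z \<inter> ball v 1 \<subseteq> surf_map ` K"
    proof
      fix u assume "u \<in> surf_map ` Z \<inter> ball v 1"
      then obtain q where q: "q \<in> Z" "u = surf_map q" "dist v u < 1" by auto
      have "norm u \<le> norm v + 1" using norm_triangle_sub[of u v] q(3) by (simp add: dist_norm norm_minus_commute)
      then show "u \<in> surf_map ` K" using q Z'(2) by (auto simp: K_def)
    qed
    moreover have "v \<in> closure (surf_map ` Z \<inter> ball v 1)"
      using v by (metis (no_types, lifting) IntI centre_in_ball closure_open_Int_superset inf_commute
        open_Int_closure_subset open_ball subsetD zero_less_one)
    ultimately have "v \<in> surf_map ` K" using cl by (metis closure_minimal subsetD)
    then show ?thesis using Z'(2) by (auto simp: K_def)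
  qed
  then have "closed (surf_map ` Z)" by (metis closure_closed closure_subset closed_closure subsetI subset_antisym)
  then show "closedin euclidean (surf_map ` Z)" by simp
qed

lemma inj_surf_map:
  assumes nd: "n = 2" "d = 3"
  shows "inj_on surf_map (surf_points - ends)"
proof -
  \<comment> \<open>A left inverse of (f1, f2). If f2 \<noteq> 0, then y is recovered as f2 R(x). If
    f2 = 0 and f1 \<noteq> 0, the point is at infinity, where f1 = i v gives v = -i f1. The origin
    comes from the only branch point that is not an end, the one of index 3.\<close>
  define G where "G = (\<lambda>(a, b). if b \<noteq> 0 then Inl (a / b, b * den Inl (a / b))
    else if a \<noteq> 0 then Inr (0, - \<i> * a) else Inl (circ 3, 0) :: point)"
  have Inl: "Inl \<in> sides" by (simp add: sides_def)
  have m: "d - n = 1" using nd by simp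
  have G: "G (f1 q, f2 q) = q" if q: "q \<in> surf_points - ends" for q
  proof -
    from q obtain u where u: "u \<in> curve" "q = Inl u \<or> q = at_inf u"
      unfolding surf_points_def by blast
    then have "flip \<i> u \<in> curve \<or> fst u = 0" using flip_curve[of u \<i>] by auto
    with u consider w where "w \<in> curve" "q = Inl w" | w where "w \<in> curve" "fst w = 0" "q = Inr w"
      unfolding at_inf_def by metis
    then show ?thesis
    proof cases
      case 1
      obtain x y where w: "w = (x, y)" by (cases w)
      have den: "den Inl x \<noteq> 0" using ends_iff[OF Inl 1(1)] q 1(2) w by simp
      have f: "f2 q = y / den Inl x" "f1 q = x * (y / den Inl x)"
        using m by (simp_all add: 1(2) w f1_def f2_def coeff_fun_def)
      show ?thesis
      proof (cases "y = 0")
        case True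
        then have "num Inl x = 0" using 1(1) den den_num[OF Inl, of x] by (simp add: w curve_def)
        moreover have "{d..<2 * n} = {3}" using nd by auto
        ultimately have "x = circ 3" by (simp add: num_def)
        then show ?thesis unfolding f using True by (simp add: G_def 1(2) w)
      next
        case False
        then show ?thesis unfolding f using den by (simp add: G_def 1(2) w)
      qed
    next
      case 2
      obtain v where w: "w = (0, v)" using 2(2) by (cases w) auto
      have "v \<noteq> 0" using 2(1) n_ge_2 by (auto simp: w curve_def power_0_left)
      then show ?thesis by (simp add: G_def 2(3) w f1_def f2_def)
    qed
  qed
  show ?thesis
  proof (rule inj_onI)
    fix q q' assume q: "q \<in> surf_points - ends" "q' \<in> surf_points - ends"
      and eq: "surf_map q = surf_map q'"
    have "f1 q = f1 q'" "f2 q = f2 q'" using eq by (simp_all add: surf_map_def real4_eq_iff)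
    then have "G (f1 q, f2 q) = G (f1 q', f2 q')" by (simp only:)
    then show "q = q'" unfolding G[OF q(1)] G[OF q(2)] .
  qed
qed

lemma embedded_surf_map:
  assumes "n = 2" "d = 3"
  shows "embedded surf ends surf_map"
  unfolding embedded_def rs_topology_surf topspace_surf
proof (rule injective_closed_imp_embedding_map[OF continuous_surf_map closed_map_surf_map])
  have "topspace (subtopology surf_top (surf_points - ends)) = surf_points - ends" by auto
  then show "inj_on surf_map (topspace (subtopology surf_top (surf_points - ends)))"
    using inj_surf_map[OF assms] by simp
qed

end

theorem theorem5p6:
  shows "(\<forall>g d :: nat. 1 \<le> g \<and> g + 2 \<le> d \<and> d \<le> 2 * g + 1 \<longrightarrow>
            (\<exists>(S :: point surface) P \<phi> (X :: point \<Rightarrow> real ^ 4).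
               symmetric_planar_example g d S P \<phi> X)) \<and>
         (\<exists>(S :: point surface) P \<phi> (X :: point \<Rightarrow> real ^ 4).
            symmetric_planar_example 1 3 S P \<phi> X \<and> embedded S P X)"
proof (intro conjI allI impI)
  fix g d :: nat assume "1 \<le> g \<and> g + 2 \<le> d \<and> d \<le> 2 * g + 1"
  then interpret symmetric_example "g + 1" d by unfold_locales auto
  show "\<exists>(S :: point surface) P \<phi> (X :: point \<Rightarrow> real ^ 4). symmetric_planar_example g d S P \<phi> X"
    using symmetric_planar_example_surf by (auto intro!: exI)
next
  interpret symmetric_example 2 3 by unfold_locales auto
  have "symmetric_planar_example 1 3 surf ends form surf_map"
    using symmetric_planar_example_surf by simp
  moreover have "embedded surf ends surf_map" by (rule embedded_surf_map) auto
  ultimately show "\<exists>(S :: point surface) P \<phi> (X :: point \<Rightarrow> real ^ 4).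
      symmetric_planar_example 1 3 S P \<phi> X \<and> embedded S P X"
    by blast
qed

end
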